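(* Let $\mathcal{S}$ be a simplicial category. Assume that, for every $X\in\mathcal{S}$ and $K\in\mathbf{sSet}$, a $K$-cylinder of $X$ and a $K$-path of $X$ exist. (1) For each $(X,K)\in\mathcal{S}\times\mathbf{sSet}$ fix a $K$-cylinder $(X\otimes K,\alpha_{K,X},\{\phi_{K,X,Y}\}_{Y\in\mathcal{S}})$ of $X$. Then there exists a unique functor $(-)\otimes(-):\mathcal{S}\times\mathbf{sSet}\to\mathcal{S}$ satisfying the following two conditions. (a) On objects, it maps $(X,K)$ to $X\otimes K$. (b) For all $X,Y\in\mathcal{S}$, $K,L\in\mathbf{sSet}$, $u\in\mathbf{sSet}(K,L)$ and $f\in\mathcal{S}(X,Y)$, $$\underline{\mathcal{S}}(X,X\otimes u)\circ\alpha_{K,X}=\alpha_{L,X}\circ u:K\to\underline{\mathcal{S}}(X,X\otimes L)$$ and $$\underline{\mathcal{S}}(X,f\otimes K)\circ\alpha_{K,X}=\underline{\mathcal{S}}(f,Y\otimes K)\circ\alpha_{K,Y}:K\to\underline{\mathcal{S}}(X,Y\otimes K).$$ (2) For each $(X,K)\in\mathcal{S}\times\mathbf{sSet}$ fix a $K$-path $(X^K,\beta_{K,X},\{\psi_{K,Y,X}\}_{Y\in\mathcal{S}})$ of $X$. Then there exists a unique functor $(-)^{(-)}:\mathcal{S}\times\mathbf{sSet}^{\mathrm{op}}\to\mathcal{S}$ satisfying the following two conditions. (a) On objects, it maps $(X,K)$ to $X^K$. (b) For all $X,Y\in\mathcal{S}$, $K,L\in\mathbf{sSet}$, $u\in\mathbf{sSet}(K,L)$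 and $f\in\mathcal{S}(Y,X)$, $$\underline{\mathcal{S}}(X^u,X)\circ\beta_{K,X}=\beta_{L,X}\circ u:K\to\underline{\mathcal{S}}(X^L,X)$$ and $$\underline{\mathcal{S}}(f^K,X)\circ\beta_{K,X}=\underline{\mathcal{S}}(Y^K,f)\circ\beta_{K,Y}:K\to\underline{\mathcal{S}}(Y^K,X).$$ Here $X\otimes u$ and $f\otimes K$ denote the values of the functor in (1) on $(\mathrm{id}_X,u)$ and $(f,\mathrm{id}_K)$, and $X^u:X^L\to X^K$ and $f^K:Y^K\to X^K$ denote the values of the functor in (2) on $(\mathrm{id}_X,u)$ and $(f,\mathrm{id}_K)$.
   Context: $\mathbf{sSet}$ is the category of simplicial sets, $\circ$ is ordinary composition in a category, and $\sigma^n_0:[n]\to[0]$ is the unique map in $\Delta$. Simplicial category: a category $\mathcal{S}$ equipped with: (S1) a functor $\underline{\mathcal{S}}(-,-):\mathcal{S}^{\mathrm{op}}\times\mathcal{S}\to\mathbf{sSet}$; (S2) for all $X,Y,Z\in\mathcal{S}$ a morphism of simplicial sets $\underline{\bullet}_{X,Y,Z}:\underline{\mathcal{S}}(X,Y)\times\underline{\mathcal{S}}(Y,Z)\to\underline{\mathcal{S}}(X,Z)$, written $(f,g)\mapsto g\,\underline{\bullet}_n f$ on $n$-simplices; (S3) a natural isomorphism $\widetilde{(\;)}:\mathcal{S}(-,-)\to\underline{\mathcal{S}}(-,-)_0$ of functors $\mathcal{S}^{\mathrm{op}}\times\mathcal{S}\to\mathbf{Set}$; such that (S4) $(h\,\underline{\bullet}_n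 g)\,\underline{\bullet}_n f=h\,\underline{\bullet}_n(g\,\underline{\bullet}_n f)$ for $f\in\underline{\mathcal{S}}(X,Y)_n$, $g\in\underline{\mathcal{S}}(Y,Z)_n$, $h\in\underline{\mathcal{S}}(Z,W)_n$; and (S5) $\underline{\mathcal{S}}(X,g)_n(f)=(\sigma^n_0)^*(\widetilde g)\,\underline{\bullet}_n f$ for $f\in\underline{\mathcal{S}}(X,Y)_n$, $g\in\mathcal{S}(Y,Z)$, and $\underline{\mathcal{S}}(f,Z)_n(g)=g\,\underline{\bullet}_n(\sigma^n_0)^*(\widetilde f)$ for $f\in\mathcal{S}(X,Y)$, $g\in\underline{\mathcal{S}}(Y,Z)_n$. Internal hom and evaluation: for $A,B\in\mathbf{sSet}$, $\underline{\mathbf{sSet}}(A,B)$ is the simplicial set with $\underline{\mathbf{sSet}}(A,B)_n=\mathbf{sSet}(A\times\Delta[n],B)$, where $\theta\in\Delta([m],[n])$ acts by precomposition with $\mathrm{id}_A\times\Delta[\theta]$. The map $\mathrm{ev}_{A,B}:A\times\underline{\mathbf{sSet}}(A,B)\to B$ is $(\mathrm{ev}_{A,B})_n(a,f)=f_n(a,\mathrm{id}_{[n]})$. $K$-cylinder of $X$: a triple $(X\otimes K,\alpha_{K,X},\{\phi_{K,X,Y}\}_{Y\in\mathcal{S}})$ consisting of an object $X\otimes K$ of $\mathcal{S}$, a morphism $\alpha_{K,X}:K\to\underline{\mathcal{S}}(X,X\otimes K)$ of $\mathbf{sSet}$, and, for every $Y\in\mathcal{S}$, an isomorphism $\phi_{K,X,Y}:\underline{\mathcal{S}}(X\otimes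 K,Y)\to\underline{\mathbf{sSet}}(K,\underline{\mathcal{S}}(X,Y))$ of $\mathbf{sSet}$ such that $\mathrm{ev}_{K,\underline{\mathcal{S}}(X,Y)}\circ(\mathrm{id}_K\times\phi_{K,X,Y})=\underline{\bullet}_{X,X\otimes K,Y}\circ(\alpha_{K,X}\times\mathrm{id}_{\underline{\mathcal{S}}(X\otimes K,Y)})$ as maps $K\times\underline{\mathcal{S}}(X\otimes K,Y)\to\underline{\mathcal{S}}(X,Y)$. $K$-path of $X$: a triple $(X^K,\beta_{K,X},\{\psi_{K,Y,X}\}_{Y\in\mathcal{S}})$ consisting of an object $X^K$ of $\mathcal{S}$, a morphism $\beta_{K,X}:K\to\underline{\mathcal{S}}(X^K,X)$ of $\mathbf{sSet}$, and, for every $Y\in\mathcal{S}$, an isomorphism $\psi_{K,Y,X}:\underline{\mathcal{S}}(Y,X^K)\to\underline{\mathbf{sSet}}(K,\underline{\mathcal{S}}(Y,X))$ of $\mathbf{sSet}$ such that $\mathrm{ev}_{K,\underline{\mathcal{S}}(Y,X)}\circ(\mathrm{id}_K\times\psi_{K,Y,X})=\underline{\bullet}_{Y,X^K,X}\circ(\mathrm{pr}_2,\beta_{K,X}\circ\mathrm{pr}_1)$ as maps $K\times\underline{\mathcal{S}}(Y,X^K)\to\underline{\mathcal{S}}(Y,X)$. *)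

theory Defs
  imports "HOL-Library.FuncSet"
begin

text \<open>
  The morphism sets of distinct pairs of objects need not be disjoint, so composition, and the
  action of a functor on morphisms, take the objects as arguments:
  \<open>Cmp C X Y Z g f\<close> is the composite of \<open>f : X \<rightarrow> Y\<close> and \<open>g : Y \<rightarrow> Z\<close>.
\<close>

record ('o, 'm) category =
  Obj :: "'o set"
  Hom :: "'o \<Rightarrow> 'o \<Rightarrow> 'm set"
  Ident :: "'o \<Rightarrow> 'm"
  Cmp :: "'o \<Rightarrow> 'o \<Rightarrow> 'o \<Rightarrow> 'm \<Rightarrow> 'm \<Rightarrow> 'm"

definition is_category :: "('o, 'm) category \<Rightarrow> bool" where
  "is_category C \<longleftrightarrow>
     (\<forall>X\<in>Obj C. Ident C X \<in> Hom C X X) \<and>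
     (\<forall>X\<in>Obj C. \<forall>Y\<in>Obj C. \<forall>Z\<in>Obj C. \<forall>f\<in>Hom C X Y. \<forall>g\<in>Hom C Y Z.
        Cmp C X Y Z g f \<in> Hom C X Z) \<and>
     (\<forall>X\<in>Obj C. \<forall>Y\<in>Obj C. \<forall>f\<in>Hom C X Y.
        Cmp C X X Y f (Ident C X) = f \<and> Cmp C X Y Y (Ident C Y) f = f) \<and>
     (\<forall>W\<in>Obj C. \<forall>X\<in>Obj C. \<forall>Y\<in>Obj C. \<forall>Z\<in>Obj C.
        \<forall>f\<in>Hom C W X. \<forall>g\<in>Hom C X Y. \<forall>h\<in>Hom C Y Z.
        Cmp C W X Z (Cmp C X Y Z h g) f = Cmp C W Y Z h (Cmp C W X Y g f))"

definition opposite :: "('o, 'm) category \<Rightarrow> ('o, 'm) category" where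
  "opposite C =
     \<lparr>Obj = Obj C,
      Hom = (\<lambda>X Y. Hom C Y X),
      Ident = Ident C,
      Cmp = (\<lambda>X Y Z g f. Cmp C Z Y X f g)\<rparr>"

definition prod_cat ::
  "('o, 'm) category \<Rightarrow> ('p, 'n) category \<Rightarrow> ('o \<times> 'p, 'm \<times> 'n) category" where
  "prod_cat C D =
     \<lparr>Obj = Obj C \<times> Obj D,
      Hom = (\<lambda>(X, X') (Y, Y'). Hom C X Y \<times> Hom D X' Y'),
      Ident = (\<lambda>(X, X'). (Ident C X, Ident D X')),
      Cmp = (\<lambda>(X, X') (Y, Y') (Z, Z') (g, g') (f, f'). (Cmp C X Y Z g f, Cmp D X' Y' Z' g' f'))\<rparr>"

record ('o, 'm, 'p, 'n) fctor =
  fobj :: "'o \<Rightarrow> 'p"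
  fmor :: "'o \<Rightarrow> 'o \<Rightarrow> 'm \<Rightarrow> 'n"

text \<open>
  A functor is required to take the value \<^term>\<open>undefined\<close> outside its source category, so that
  two functors are equal in HOL iff they agree on the objects and morphisms of the source.
\<close>

definition is_functor ::
  "('o, 'm) category \<Rightarrow> ('p, 'n) category \<Rightarrow> ('o, 'm, 'p, 'n) fctor \<Rightarrow> bool" where
  "is_functor C D F \<longleftrightarrow>
     (\<forall>X\<in>Obj C. fobj F X \<in> Obj D) \<and>
     (\<forall>X\<in>Obj C. \<forall>Y\<in>Obj C. \<forall>f\<in>Hom C X Y. fmor F X Y f \<in> Hom D (fobj F X) (fobj F Y)) \<and>
     (\<forall>X\<in>Obj C. fmor F X X (Ident C X) = Ident D (fobj F X)) \<and>
     (\<forall>X\<in>Obj C. \<forall>Y\<in>Obj C. \<forall>Z\<in>Obj C. \<forall>f\<in>Hom C X Y. \<forall>g\<in>Hom C Y Z.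
        fmor F X Z (Cmp C X Y Z g f)
          = Cmp D (fobj F X) (fobj F Y) (fobj F Z) (fmor F Y Z g) (fmor F X Y f)) \<and>
     (\<forall>X. X \<notin> Obj C \<longrightarrow> fobj F X = undefined) \<and>
     (\<forall>X Y f. \<not> (X \<in> Obj C \<and> Y \<in> Obj C \<and> f \<in> Hom C X Y) \<longrightarrow> fmor F X Y f = undefined)"

definition mk_functor ::
  "('o, 'm) category \<Rightarrow> ('o \<Rightarrow> 'p) \<Rightarrow> ('o \<Rightarrow> 'o \<Rightarrow> 'm \<Rightarrow> 'n) \<Rightarrow> ('o, 'm, 'p, 'n) fctor" where
  "mk_functor C fo fm =
     \<lparr>fobj = (\<lambda>X. if X \<in> Obj C then fo X else undefined),
      fmor = (\<lambda>X Y f. if X \<in> Obj C \<and> Y \<in> Obj C \<and> f \<in> Hom C X Y then fm X Y f else undefined)\<rparr>"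

definition Set_cat :: "('a set, 'a \<Rightarrow> 'a) category" where
  "Set_cat =
     \<lparr>Obj = UNIV,
      Hom = (\<lambda>A B. A \<rightarrow>\<^sub>E B),
      Ident = (\<lambda>A. \<lambda>x\<in>A. x),
      Cmp = (\<lambda>A B C g f. compose A g f)\<rparr>"

text \<open>
  Natural transformations between set-valued functors. The two functors may take values in
  subsets of different types (e.g. a product of simplicial sets, or an internal hom, lives over
  another type than its constituents).
\<close>

definition set_nat ::
  "('o, 'm) category \<Rightarrow> ('o, 'm, 'a set, 'a \<Rightarrow> 'a) fctor \<Rightarrow> ('o, 'm, 'b set, 'b \<Rightarrow> 'b) fctor
     \<Rightarrow> ('o \<Rightarrow> 'a \<Rightarrow> 'b) set" where
  "set_nat C F G =
     {\<eta> \<in> (\<Pi>\<^sub>E X\<in>Obj C. fobj F X \<rightarrow>\<^sub>E fobj G X).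
        \<forall>X\<in>Obj C. \<forall>Y\<in>Obj C. \<forall>f\<in>Hom C X Y. \<forall>x\<in>fobj F X.
          \<eta> Y (fmor F X Y f x) = fmor G X Y f (\<eta> X x)}"

definition set_nat_id ::
  "('o, 'm) category \<Rightarrow> ('o, 'm, 'a set, 'a \<Rightarrow> 'a) fctor \<Rightarrow> ('o \<Rightarrow> 'a \<Rightarrow> 'a)" where
  "set_nat_id C F = (\<lambda>X\<in>Obj C. \<lambda>x\<in>fobj F X. x)"

definition set_nat_comp ::
  "('o, 'm) category \<Rightarrow> ('o, 'm, 'a set, 'a \<Rightarrow> 'a) fctor
     \<Rightarrow> ('o \<Rightarrow> 'b \<Rightarrow> 'c) \<Rightarrow> ('o \<Rightarrow> 'a \<Rightarrow> 'b) \<Rightarrow> ('o \<Rightarrow> 'a \<Rightarrow> 'c)" where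
  "set_nat_comp C F \<epsilon> \<eta> = (\<lambda>X\<in>Obj C. compose (fobj F X) (\<epsilon> X) (\<eta> X))"

definition set_nat_iso ::
  "('o, 'm) category \<Rightarrow> ('o, 'm, 'a set, 'a \<Rightarrow> 'a) fctor \<Rightarrow> ('o, 'm, 'b set, 'b \<Rightarrow> 'b) fctor
     \<Rightarrow> ('o \<Rightarrow> 'a \<Rightarrow> 'b) set" where
  "set_nat_iso C F G =
     {\<eta> \<in> set_nat C F G. \<exists>\<epsilon>\<in>set_nat C G F.
        set_nat_comp C F \<epsilon> \<eta> = set_nat_id C F \<and> set_nat_comp C G \<eta> \<epsilon> = set_nat_id C G}"

definition hom_functor ::
  "('o, 'm) category \<Rightarrow> ('o \<times> 'o, 'm \<times> 'm, 'm set, 'm \<Rightarrow> 'm) fctor" where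
  "hom_functor C =
     mk_functor (prod_cat (opposite C) C)
       (\<lambda>(X, Y). Hom C X Y)
       (\<lambda>(X, Y) (X', Y') (a, b). \<lambda>f\<in>Hom C X Y. Cmp C X' Y Y' b (Cmp C X' X Y f a))"

text \<open>The object \<open>[n] = {0, \<dots>, n}\<close> of the simplex category is represented by \<open>n\<close>.\<close>

definition Delta :: "(nat, nat \<Rightarrow> nat) category" where
  "Delta =
     \<lparr>Obj = UNIV,
      Hom = (\<lambda>m n. {\<theta> \<in> {..m} \<rightarrow>\<^sub>E {..n}. mono_on {..m} \<theta>}),
      Ident = (\<lambda>n. \<lambda>i\<in>{..n}. i),
      Cmp = (\<lambda>k m n \<theta> \<eta>. compose {..k} \<theta> \<eta>)\<rparr>"

text \<open>
  A simplicial set \<open>K\<close> has the set \<open>fobj K n\<close> of \<open>n\<close>-simplices, and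
  \<open>\<theta> : [m] \<rightarrow> [n]\<close> acts by \<open>fmor K n m \<theta>\<close>, from \<open>n\<close>-simplices to \<open>m\<close>-simplices.
\<close>

type_synonym 'a sset = "(nat, nat \<Rightarrow> nat, 'a set, 'a \<Rightarrow> 'a) fctor"

definition smap :: "'a sset \<Rightarrow> 'b sset \<Rightarrow> (nat \<Rightarrow> 'a \<Rightarrow> 'b) set" where
  "smap K L = set_nat (opposite Delta) K L"

definition siso :: "'a sset \<Rightarrow> 'b sset \<Rightarrow> (nat \<Rightarrow> 'a \<Rightarrow> 'b) set" where
  "siso K L = set_nat_iso (opposite Delta) K L"

definition sid :: "'a sset \<Rightarrow> nat \<Rightarrow> 'a \<Rightarrow> 'a" where
  "sid K = set_nat_id (opposite Delta) K"

definition scmp :: "'a sset \<Rightarrow> (nat \<Rightarrow> 'b \<Rightarrow> 'c) \<Rightarrow> (nat \<Rightarrow> 'a \<Rightarrow> 'b) \<Rightarrow> (nat \<Rightarrow> 'a \<Rightarrow> 'c)" where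
  "scmp K v u = set_nat_comp (opposite Delta) K v u"

text \<open>
  \<open>sSet :: ('a sset, _) category\<close> has as objects the simplicial sets whose sets of simplices are
  subsets of the type \<^typ>\<open>'a\<close>, which thus plays the role of the universe of small sets.
\<close>

definition sSet :: "('a sset, nat \<Rightarrow> 'a \<Rightarrow> 'a) category" where
  "sSet =
     \<lparr>Obj = {K. is_functor (opposite Delta) Set_cat K},
      Hom = smap,
      Ident = sid,
      Cmp = (\<lambda>K L M v u. scmp K v u)\<rparr>"

definition sprod :: "'a sset \<Rightarrow> 'b sset \<Rightarrow> ('a \<times> 'b) sset" where
  "sprod K L =
     mk_functor (opposite Delta)
       (\<lambda>n. fobj K n \<times> fobj L n)
       (\<lambda>n m \<theta>. \<lambda>(a, b)\<in>fobj K n \<times> fobj L n. (fmor K n m \<theta> a, fmor L n m \<theta> b))"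

definition spr1 :: "'a sset \<Rightarrow> 'b sset \<Rightarrow> nat \<Rightarrow> 'a \<times> 'b \<Rightarrow> 'a" where
  "spr1 K L = (\<lambda>n. \<lambda>(a, b)\<in>fobj K n \<times> fobj L n. a)"

definition spr2 :: "'a sset \<Rightarrow> 'b sset \<Rightarrow> nat \<Rightarrow> 'a \<times> 'b \<Rightarrow> 'b" where
  "spr2 K L = (\<lambda>n. \<lambda>(a, b)\<in>fobj K n \<times> fobj L n. b)"

definition spair ::
  "'a sset \<Rightarrow> (nat \<Rightarrow> 'a \<Rightarrow> 'b) \<Rightarrow> (nat \<Rightarrow> 'a \<Rightarrow> 'c) \<Rightarrow> nat \<Rightarrow> 'a \<Rightarrow> 'b \<times> 'c" where
  "spair K u v = (\<lambda>n. \<lambda>a\<in>fobj K n. (u n a, v n a))"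

text \<open>\<open>sprod_map K L u v\<close> is \<open>u \<times> v\<close> for \<open>u : K \<rightarrow> K'\<close> and \<open>v : L \<rightarrow> L'\<close>.\<close>

definition sprod_map ::
  "'a sset \<Rightarrow> 'b sset \<Rightarrow> (nat \<Rightarrow> 'a \<Rightarrow> 'c) \<Rightarrow> (nat \<Rightarrow> 'b \<Rightarrow> 'd) \<Rightarrow> nat \<Rightarrow> 'a \<times> 'b \<Rightarrow> 'c \<times> 'd" where
  "sprod_map K L u v = (\<lambda>n. \<lambda>(a, b)\<in>fobj K n \<times> fobj L n. (u n a, v n b))"

definition simplex :: "nat \<Rightarrow> (nat \<Rightarrow> nat) sset" where
  "simplex n =
     mk_functor (opposite Delta)
       (\<lambda>k. Hom Delta k n)
       (\<lambda>l k \<eta>. \<lambda>\<alpha>\<in>Hom Delta l n. Cmp Delta k l n \<alpha> \<eta>)"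

definition simplex_map :: "nat \<Rightarrow> nat \<Rightarrow> (nat \<Rightarrow> nat) \<Rightarrow> nat \<Rightarrow> (nat \<Rightarrow> nat) \<Rightarrow> (nat \<Rightarrow> nat)" where
  "simplex_map m n \<theta> = (\<lambda>k. \<lambda>\<alpha>\<in>Hom Delta k m. Cmp Delta k m n \<theta> \<alpha>)"

definition ihom :: "'a sset \<Rightarrow> 'b sset \<Rightarrow> (nat \<Rightarrow> 'a \<times> (nat \<Rightarrow> nat) \<Rightarrow> 'b) sset" where
  "ihom A B =
     mk_functor (opposite Delta)
       (\<lambda>n. smap (sprod A (simplex n)) B)
       (\<lambda>n m \<theta>. \<lambda>f\<in>smap (sprod A (simplex n)) B.
          scmp (sprod A (simplex m)) f
            (sprod_map A (simplex m) (sid A) (simplex_map m n \<theta>)))"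

definition ev ::
  "'a sset \<Rightarrow> 'b sset \<Rightarrow> nat \<Rightarrow> 'a \<times> (nat \<Rightarrow> 'a \<times> (nat \<Rightarrow> nat) \<Rightarrow> 'b) \<Rightarrow> 'b" where
  "ev A B = (\<lambda>n. \<lambda>(a, f)\<in>fobj A n \<times> fobj (ihom A B) n. f n (a, Ident Delta n))"

text \<open>
  \<open>shom\<close> is the functor \<open>S\<^sup>o\<^sup>p \<times> S \<rightarrow> sSet\<close>; \<open>bul S X Y Z n (f, g)\<close> is the composite written
  \<open>g \<bullet>\<^sub>n f\<close>; \<open>tld S (X, Y)\<close> is the bijection from \<open>Hom X Y\<close> to the vertices of \<open>shom\<close>.
\<close>

record ('o, 'm, 's) scategory =
  und :: "('o, 'm) category"
  shom :: "('o \<times> 'o, 'm \<times> 'm, 's sset, nat \<Rightarrow> 's \<Rightarrow> 's) fctor"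
  bul :: "'o \<Rightarrow> 'o \<Rightarrow> 'o \<Rightarrow> nat \<Rightarrow> 's \<times> 's \<Rightarrow> 's"
  tld :: "'o \<times> 'o \<Rightarrow> 'm \<Rightarrow> 's"

abbreviation SH :: "('o, 'm, 's) scategory \<Rightarrow> 'o \<Rightarrow> 'o \<Rightarrow> 's sset" where
  "SH S X Y \<equiv> fobj (shom S) (X, Y)"

text \<open>\<open>post S X Y Z g\<close> is \<open>S(X, g) : S(X, Y) \<rightarrow> S(X, Z)\<close> for \<open>g : Y \<rightarrow> Z\<close>.\<close>

definition post :: "('o, 'm, 's) scategory \<Rightarrow> 'o \<Rightarrow> 'o \<Rightarrow> 'o \<Rightarrow> 'm \<Rightarrow> nat \<Rightarrow> 's \<Rightarrow> 's" where
  "post S X Y Z g = fmor (shom S) (X, Y) (X, Z) (Ident (und S) X, g)"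

text \<open>\<open>pre S X Y Z f\<close> is \<open>S(f, Z) : S(Y, Z) \<rightarrow> S(X, Z)\<close> for \<open>f : X \<rightarrow> Y\<close>.\<close>

definition pre :: "('o, 'm, 's) scategory \<Rightarrow> 'o \<Rightarrow> 'o \<Rightarrow> 'o \<Rightarrow> 'm \<Rightarrow> nat \<Rightarrow> 's \<Rightarrow> 's" where
  "pre S X Y Z f = fmor (shom S) (Y, Z) (X, Z) (f, Ident (und S) Z)"

text \<open>\<open>degen S X Y n f\<close> is the pullback of the vertex of \<open>f : X \<rightarrow> Y\<close> along \<open>[n] \<rightarrow> [0]\<close>.\<close>

definition degen :: "('o, 'm, 's) scategory \<Rightarrow> 'o \<Rightarrow> 'o \<Rightarrow> nat \<Rightarrow> 'm \<Rightarrow> 's" where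
  "degen S X Y n f = fmor (SH S X Y) 0 n (\<lambda>i\<in>{..n}. 0) (tld S (X, Y) f)"

definition vertices ::
  "('o, 'm, 's) scategory \<Rightarrow> ('o \<times> 'o, 'm \<times> 'm, 's set, 's \<Rightarrow> 's) fctor" where
  "vertices S =
     mk_functor (prod_cat (opposite (und S)) (und S))
       (\<lambda>p. fobj (fobj (shom S) p) 0)
       (\<lambda>p q h. fmor (shom S) p q h 0)"

definition is_scategory :: "('o, 'm, 's) scategory \<Rightarrow> bool" where
  "is_scategory S \<longleftrightarrow>
     is_category (und S) \<and>
     is_functor (prod_cat (opposite (und S)) (und S)) sSet (shom S) \<and>
     (\<forall>X\<in>Obj (und S). \<forall>Y\<in>Obj (und S). \<forall>Z\<in>Obj (und S).
        bul S X Y Z \<in> smap (sprod (SH S X Y) (SH S Y Z)) (SH S X Z)) \<and>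
     tld S \<in> set_nat_iso (prod_cat (opposite (und S)) (und S)) (hom_functor (und S)) (vertices S) \<and>
     (\<forall>X\<in>Obj (und S). \<forall>Y\<in>Obj (und S). \<forall>Z\<in>Obj (und S). \<forall>W\<in>Obj (und S). \<forall>n.
        \<forall>f\<in>fobj (SH S X Y) n. \<forall>g\<in>fobj (SH S Y Z) n. \<forall>h\<in>fobj (SH S Z W) n.
        bul S X Y W n (f, bul S Y Z W n (g, h)) = bul S X Z W n (bul S X Y Z n (f, g), h)) \<and>
     (\<forall>X\<in>Obj (und S). \<forall>Y\<in>Obj (und S). \<forall>Z\<in>Obj (und S). \<forall>n.
        \<forall>f\<in>fobj (SH S X Y) n. \<forall>g\<in>Hom (und S) Y Z.
        post S X Y Z g n f = bul S X Y Z n (f, degen S Y Z n g)) \<and>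
     (\<forall>X\<in>Obj (und S). \<forall>Y\<in>Obj (und S). \<forall>Z\<in>Obj (und S). \<forall>n.
        \<forall>f\<in>Hom (und S) X Y. \<forall>g\<in>fobj (SH S Y Z) n.
        pre S X Y Z f n g = bul S X Y Z n (degen S X Y n f, g))"

definition is_cylinder ::
  "('o, 'm, 's) scategory \<Rightarrow> 'k sset \<Rightarrow> 'o \<Rightarrow>
     'o \<times> (nat \<Rightarrow> 'k \<Rightarrow> 's) \<times> ('o \<Rightarrow> nat \<Rightarrow> 's \<Rightarrow> (nat \<Rightarrow> 'k \<times> (nat \<Rightarrow> nat) \<Rightarrow> 's)) \<Rightarrow> bool" where
  "is_cylinder S K X = (\<lambda>(T, \<alpha>, \<phi>).
     T \<in> Obj (und S) \<and>
     \<alpha> \<in> smap K (SH S X T) \<and>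
     (\<forall>Y\<in>Obj (und S).
        \<phi> Y \<in> siso (SH S T Y) (ihom K (SH S X Y)) \<and>
        scmp (sprod K (SH S T Y)) (ev K (SH S X Y)) (sprod_map K (SH S T Y) (sid K) (\<phi> Y))
          = scmp (sprod K (SH S T Y)) (bul S X T Y)
              (sprod_map K (SH S T Y) \<alpha> (sid (SH S T Y)))))"

definition is_path ::
  "('o, 'm, 's) scategory \<Rightarrow> 'k sset \<Rightarrow> 'o \<Rightarrow>
     'o \<times> (nat \<Rightarrow> 'k \<Rightarrow> 's) \<times> ('o \<Rightarrow> nat \<Rightarrow> 's \<Rightarrow> (nat \<Rightarrow> 'k \<times> (nat \<Rightarrow> nat) \<Rightarrow> 's)) \<Rightarrow> bool" where
  "is_path S K X = (\<lambda>(P, \<beta>, \<psi>).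
     P \<in> Obj (und S) \<and>
     \<beta> \<in> smap K (SH S P X) \<and>
     (\<forall>Y\<in>Obj (und S).
        \<psi> Y \<in> siso (SH S Y P) (ihom K (SH S Y X)) \<and>
        scmp (sprod K (SH S Y P)) (ev K (SH S Y X)) (sprod_map K (SH S Y P) (sid K) (\<psi> Y))
          = scmp (sprod K (SH S Y P)) (bul S Y P X)
              (spair (sprod K (SH S Y P)) (spr2 K (SH S Y P))
                 (scmp (sprod K (SH S Y P)) \<beta> (spr1 K (SH S Y P))))))"

end

(* For a K-cylinder of X, naturality of phi along [n] -> [0] together with the evaluation formula
   identifies the map S(T,Y) -> sSet(K, S(X,Y)), g |-> S(X,g) o alpha, with the restriction of phi
   to vertices. Hence X (x) K with alpha represents Y |-> sSet(K, S(X,Y)), which is functorial in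
   X and K, and condition (b) says that alpha is natural in each variable separately. So (1) is
   the uniqueness of a parametrized representing functor, and (2) is its dual. *)
theory Submission
  imports Defs
begin

subsection \<open>Categories and functors\<close>

text \<open>Vertices suffice because two facts meet at the map \<open>[n] \<rightarrow> [0]\<close>.
  A map on \<open>K \<times> \<Delta>[0]\<close> is fixed by its values over the unique
  \<open>n\<close>-simplex of \<open>\<Delta>[0]\<close>, and pulling back along
  \<open>[n] \<rightarrow> [0]\<close> turns such a value into an evaluation at an identity simplex,
  which the evaluation formula computes. Then (S5) reads composition with a degenerate vertex as the
  action of the morphism itself. \<open>K\<close> lives over the type \<open>'k\<close> and
  \<open>S(X, Y)\<close> over \<open>'s\<close>, so \<open>sSet(K, S(X, Y))\<close> is not a hom set
  of one category \<open>sSet\<close>; it is assembled as a set-valued functor from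
  \<open>smap\<close>, which allows two types. Duality is applied only to such functors: the path
  case reverses plain categories and the functor obtained, and no opposite simplicial category is
  formed.\<close>

lemma opposite_simps [simp]:
  "Obj (opposite C) = Obj C" "Hom (opposite C) X Y = Hom C Y X"
  "Ident (opposite C) = Ident C" "Cmp (opposite C) X Y Z g f = Cmp C Z Y X f g"
  by (simp_all add: opposite_def)

lemma prod_cat_simps [simp]:
  "Obj (prod_cat C D) = Obj C \<times> Obj D"
  "Hom (prod_cat C D) (X, X') (Y, Y') = Hom C X Y \<times> Hom D X' Y'"
  "Ident (prod_cat C D) (X, X') = (Ident C X, Ident D X')"
  "Cmp (prod_cat C D) (X, X') (Y, Y') (Z, Z') (g, g') (f, f') = (Cmp C X Y Z g f, Cmp D X' Y' Z' g' f')"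
  by (simp_all add: prod_cat_def)

lemma Set_cat_simps [simp]:
  "Obj Set_cat = UNIV" "Hom Set_cat A B = (A \<rightarrow>\<^sub>E B)"
  "Ident Set_cat A = (\<lambda>x\<in>A. x)" "Cmp Set_cat A B D g f = compose A g f"
  by (simp_all add: Set_cat_def)

lemma mk_functor_simps [simp]:
  "X \<in> Obj C \<Longrightarrow> fobj (mk_functor C fo fm) X = fo X"
  "X \<in> Obj C \<Longrightarrow> Y \<in> Obj C \<Longrightarrow> f \<in> Hom C X Y \<Longrightarrow> fmor (mk_functor C fo fm) X Y f = fm X Y f"
  by (simp_all add: mk_functor_def)

lemma is_categoryD:
  assumes "is_category C"
  shows "\<And>X. X \<in> Obj C \<Longrightarrow> Ident C X \<in> Hom C X X"
    and "\<And>X Y Z f g. \<lbrakk>X \<in> Obj C; Y \<in> Obj C; Z \<in> Obj C; f \<in> Hom C X Y; g \<in> Hom C Y Z\<rbrakk>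
           \<Longrightarrow> Cmp C X Y Z g f \<in> Hom C X Z"
    and "\<And>X Y f. \<lbrakk>X \<in> Obj C; Y \<in> Obj C; f \<in> Hom C X Y\<rbrakk> \<Longrightarrow> Cmp C X X Y f (Ident C X) = f"
    and "\<And>X Y f. \<lbrakk>X \<in> Obj C; Y \<in> Obj C; f \<in> Hom C X Y\<rbrakk> \<Longrightarrow> Cmp C X Y Y (Ident C Y) f = f"
    and "\<And>W X Y Z f g h. \<lbrakk>W \<in> Obj C; X \<in> Obj C; Y \<in> Obj C; Z \<in> Obj C;
           f \<in> Hom C W X; g \<in> Hom C X Y; h \<in> Hom C Y Z\<rbrakk>
           \<Longrightarrow> Cmp C W X Z (Cmp C X Y Z h g) f = Cmp C W Y Z h (Cmp C W X Y g f)"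
  using assms unfolding is_category_def by blast+

lemma is_functorD:
  assumes "is_functor C D F"
  shows "\<And>X. X \<in> Obj C \<Longrightarrow> fobj F X \<in> Obj D"
    and "\<And>X Y f. \<lbrakk>X \<in> Obj C; Y \<in> Obj C; f \<in> Hom C X Y\<rbrakk>
           \<Longrightarrow> fmor F X Y f \<in> Hom D (fobj F X) (fobj F Y)"
    and "\<And>X. X \<in> Obj C \<Longrightarrow> fmor F X X (Ident C X) = Ident D (fobj F X)"
    and "\<And>X Y Z f g. \<lbrakk>X \<in> Obj C; Y \<in> Obj C; Z \<in> Obj C; f \<in> Hom C X Y; g \<in> Hom C Y Z\<rbrakk>
           \<Longrightarrow> fmor F X Z (Cmp C X Y Z g f)
             = Cmp D (fobj F X) (fobj F Y) (fobj F Z) (fmor F Y Z g) (fmor F X Y f)"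
    and "\<And>X. X \<notin> Obj C \<Longrightarrow> fobj F X = undefined"
    and "\<And>X Y f. \<not> (X \<in> Obj C \<and> Y \<in> Obj C \<and> f \<in> Hom C X Y) \<Longrightarrow> fmor F X Y f = undefined"
  using assms unfolding is_functor_def by blast+

lemma is_functor_mk_functor:
  assumes "is_category C"
    and "\<And>X. X \<in> Obj C \<Longrightarrow> fo X \<in> Obj D"
    and "\<And>X Y f. \<lbrakk>X \<in> Obj C; Y \<in> Obj C; f \<in> Hom C X Y\<rbrakk> \<Longrightarrow> fm X Y f \<in> Hom D (fo X) (fo Y)"
    and "\<And>X. X \<in> Obj C \<Longrightarrow> fm X X (Ident C X) = Ident D (fo X)"
    and "\<And>X Y Z f g. \<lbrakk>X \<in> Obj C; Y \<in> Obj C; Z \<in> Obj C; f \<in> Hom C X Y; g \<in> Hom C Y Z\<rbrakk>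
           \<Longrightarrow> fm X Z (Cmp C X Y Z g f) = Cmp D (fo X) (fo Y) (fo Z) (fm Y Z g) (fm X Y f)"
  shows "is_functor C D (mk_functor C fo fm)"
  unfolding is_functor_def
  using is_categoryD(1,2)[OF assms(1)] assms(2-5) by (auto simp: mk_functor_def)

lemma functor_eqI:
  assumes "is_functor C D F" "is_functor C D G"
    and "\<And>X. X \<in> Obj C \<Longrightarrow> fobj F X = fobj G X"
    and "\<And>X Y f. \<lbrakk>X \<in> Obj C; Y \<in> Obj C; f \<in> Hom C X Y\<rbrakk> \<Longrightarrow> fmor F X Y f = fmor G X Y f"
  shows "F = G"
proof -
  have "fobj F = fobj G"
    using assms(3) is_functorD(5)[OF assms(1)] is_functorD(5)[OF assms(2)] by (metis ext)
  moreover have "fmor F X Y f = fmor G X Y f" for X Y f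
    using assms(4) is_functorD(6)[OF assms(1)] is_functorD(6)[OF assms(2)] by metis
  then have "fmor F = fmor G" by blast
  ultimately show ?thesis by simp
qed

lemma is_category_opposite: "is_category C \<Longrightarrow> is_category (opposite C)"
  unfolding is_category_def by simp

lemma is_category_prod_cat:
  "is_category C \<Longrightarrow> is_category D \<Longrightarrow> is_category (prod_cat C D)"
  unfolding is_category_def by auto

text \<open>The same assignment read as a functor between the opposite categories. Since
  \<open>fmor\<close> takes source and target as arguments, reversal shows only as a swap of
  these.\<close>

definition opposite_functor :: "('o, 'm, 'p, 'n) fctor \<Rightarrow> ('o, 'm, 'p, 'n) fctor" where
  "opposite_functor F = \<lparr>fobj = fobj F, fmor = (\<lambda>X Y f. fmor F Y X f)\<rparr>"

lemma opposite_functor_simps [simp]: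
  "fobj (opposite_functor F) = fobj F" "fmor (opposite_functor F) X Y f = fmor F Y X f"
  "opposite_functor (opposite_functor F) = F"
  by (simp_all add: opposite_functor_def)

text \<open>\<open>opposite_functor\<close> is an involution, so unique existence can be checked
  after reversal.\<close>

lemma ex1_opposite_functor:
  assumes "\<exists>!F. P (opposite_functor F)"
  shows "\<exists>!F. P F"
proof -
  obtain F where F: "P (opposite_functor F)" "\<And>G. P (opposite_functor G) \<Longrightarrow> G = F"
    using assms by blast
  have "G = opposite_functor F" if "P G" for G
    using F(2)[of "opposite_functor G"] that by auto
  with F(1) show ?thesis by blast
qed

lemma is_functor_opposite [simp]:
  "is_functor (opposite C) (opposite D) (opposite_functor F) \<longleftrightarrow> is_functor C D F"
  unfolding is_functor_def by (simp; blast)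

subsection \<open>Parametrized representability\<close>

text \<open>
  If \<open>(T b, \<alpha> b)\<close> represents \<open>H(b, -)\<close>, then \<open>natural_at\<close> at \<open>h : b \<rightarrow> b'\<close> is naturality of
  the representing isomorphisms at \<open>h\<close>, read off at the universal element.
\<close>

definition natural_at ::
  "('b, 'm) category \<Rightarrow> ('c, 'n) category \<Rightarrow> ('b \<times> 'c, 'm \<times> 'n, 'e set, 'e \<Rightarrow> 'e) fctor
     \<Rightarrow> ('b \<Rightarrow> 'c) \<Rightarrow> ('b \<Rightarrow> 'e) \<Rightarrow> 'b \<Rightarrow> 'b \<Rightarrow> 'm \<Rightarrow> 'n \<Rightarrow> bool" where
  "natural_at B C H T \<alpha> b b' h g \<longleftrightarrow>
     fmor H (b, T b) (b, T b') (Ident B b, g) (\<alpha> b)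
       = fmor H (b', T b') (b, T b') (h, Ident C (T b')) (\<alpha> b')"

context
  fixes B :: "('b, 'm) category" and C :: "('c, 'n) category"
    and H :: "('b \<times> 'c, 'm \<times> 'n, 'e set, 'e \<Rightarrow> 'e) fctor"
    and T :: "'b \<Rightarrow> 'c" and \<alpha> :: "'b \<Rightarrow> 'e"
  assumes B: "is_category B" and C: "is_category C"
    and H: "is_functor (prod_cat (opposite B) C) Set_cat H"
    and T: "\<And>b. b \<in> Obj B \<Longrightarrow> T b \<in> Obj C"
    and \<alpha>: "\<And>b. b \<in> Obj B \<Longrightarrow> \<alpha> b \<in> fobj H (b, T b)"
begin

lemma bifunctor_comp:
  assumes "b \<in> Obj B" "b' \<in> Obj B" "b'' \<in> Obj B" "y \<in> Obj C" "y' \<in> Obj C" "y'' \<in> Obj C"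
    and "h \<in> Hom B b' b" "h' \<in> Hom B b'' b'" "g \<in> Hom C y y'" "g' \<in> Hom C y' y''"
    and "m \<in> fobj H (b, y)"
  shows "fmor H (b', y') (b'', y'') (h', g') (fmor H (b, y) (b', y') (h, g) m)
    = fmor H (b, y) (b'', y'') (Cmp B b'' b' b h h', Cmp C y y' y'' g' g) m"
  using is_functorD(4)[OF H, of "(b, y)" "(b', y')" "(b'', y'')" "(h, g)" "(h', g')"] assms
  by (simp add: compose_def)

lemma natural_at_Ident:
  assumes "b \<in> Obj B"
  shows "natural_at B C H T \<alpha> b b (Ident B b) (Ident C (T b))"
  by (simp add: natural_at_def)

text \<open>Two naturality squares paste: the first trades the action of \<open>g\<close> on
  \<open>\<alpha> b\<close> for that of \<open>h\<close> on \<open>\<alpha> b'\<close>, the second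
  does the same with \<open>g'\<close>, \<open>h'\<close> and \<open>\<alpha> b''\<close>.\<close>

lemma natural_at_comp:
  assumes "b \<in> Obj B" "b' \<in> Obj B" "b'' \<in> Obj B" "h \<in> Hom B b b'" "h' \<in> Hom B b' b''"
    and "g \<in> Hom C (T b) (T b')" "g' \<in> Hom C (T b') (T b'')"
    and n: "natural_at B C H T \<alpha> b b' h g" and n': "natural_at B C H T \<alpha> b' b'' h' g'"
  shows "natural_at B C H T \<alpha> b b'' (Cmp B b b' b'' h' h) (Cmp C (T b) (T b') (T b'') g' g)"
proof -
  note [simp] = assms(1-7) T \<alpha> is_categoryD[OF B] is_categoryD[OF C]
  have "fmor H (b, T b) (b, T b'') (Ident B b, Cmp C (T b) (T b') (T b'') g' g) (\<alpha> b)
      = fmor H (b, T b') (b, T b'') (Ident B b, g')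
          (fmor H (b, T b) (b, T b') (Ident B b, g) (\<alpha> b))"
    by (subst bifunctor_comp) simp_all
  \<comment> \<open>Interchange: after using \<open>n\<close>, the actions of \<open>h\<close> and
    \<open>g'\<close> sit in different variables and commute, as both orders give the action of
    \<open>(h, g')\<close>.\<close>
  also have "\<dots> = fmor H (b', T b'') (b, T b'') (h, Ident C (T b''))
      (fmor H (b', T b') (b', T b'') (Ident B b', g') (\<alpha> b'))"
    using n unfolding natural_at_def by (simp add: bifunctor_comp)
  also have "\<dots> = fmor H (b'', T b'') (b, T b'') (Cmp B b b' b'' h' h, Ident C (T b'')) (\<alpha> b'')"
    using n' unfolding natural_at_def by (simp add: bifunctor_comp)
  finally show ?thesis by (simp add: natural_at_def)
qed

text \<open>\<open>univ\<close> makes \<open>\<alpha> b\<close> a universal element of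
  \<open>H(b, -)\<close>. Pulling \<open>\<alpha> b'\<close> back along \<open>h\<close> gives an
  element of \<open>H(b, T b')\<close>, and the value of the functor at \<open>h\<close> has to be
  the one morphism classifying it.\<close>

lemma representing_functor:
  assumes univ: "\<And>b y m. \<lbrakk>b \<in> Obj B; y \<in> Obj C; m \<in> fobj H (b, y)\<rbrakk> \<Longrightarrow>
      \<exists>!g. g \<in> Hom C (T b) y \<and> fmor H (b, T b) (b, y) (Ident B b, g) (\<alpha> b) = m"
  shows "\<exists>!F. is_functor B C F \<and> (\<forall>b\<in>Obj B. fobj F b = T b) \<and>
    (\<forall>b\<in>Obj B. \<forall>b'\<in>Obj B. \<forall>h\<in>Hom B b b'. natural_at B C H T \<alpha> b b' h (fmor F b b' h))"
proof -
  have ex1: "\<exists>!g. g \<in> Hom C (T b) (T b') \<and> natural_at B C H T \<alpha> b b' h g"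
    if "b \<in> Obj B" "b' \<in> Obj B" "h \<in> Hom B b b'" for b b' h
  proof -
    have "fmor H (b', T b') (b, T b') (h, Ident C (T b')) (\<alpha> b') \<in> fobj H (b, T b')"
      using is_functorD(2)[OF H, of "(b', T b')" "(b, T b')" "(h, Ident C (T b'))"]
        that T \<alpha> is_categoryD(1)[OF C] by (auto dest: PiE_mem)
    then show ?thesis
      unfolding natural_at_def using univ that(1,2) T by simp
  qed
  define fm where
    "fm = (\<lambda>b b' h. THE g. g \<in> Hom C (T b) (T b') \<and> natural_at B C H T \<alpha> b b' h g)"
  have fm: "fm b b' h \<in> Hom C (T b) (T b')" "natural_at B C H T \<alpha> b b' h (fm b b' h)"
    if "b \<in> Obj B" "b' \<in> Obj B" "h \<in> Hom B b b'" for b b' h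
    using theI'[OF ex1[OF that]] unfolding fm_def by blast+
  have fm_eq: "fm b b' h = g"
    if "b \<in> Obj B" "b' \<in> Obj B" "h \<in> Hom B b b'" "g \<in> Hom C (T b) (T b')"
      "natural_at B C H T \<alpha> b b' h g" for b b' h g
    using ex1[OF that(1-3)] fm[OF that(1-3)] that(4,5) by blast
  \<comment> \<open>Uniqueness proves both functor laws: identities and composites satisfy the
    naturality that characterizes the chosen value.\<close>
  have F: "is_functor B C (mk_functor B T fm)"
    by (rule is_functor_mk_functor)
      (auto simp: B T fm intro!: fm_eq natural_at_comp natural_at_Ident
         is_categoryD(1,2)[OF B] is_categoryD(1,2)[OF C])
  show ?thesis
  proof (rule ex1I[of _ "mk_functor B T fm"], intro conjI)
    show "is_functor B C (mk_functor B T fm)" by (fact F)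
    fix G
    assume G: "is_functor B C G \<and> (\<forall>b\<in>Obj B. fobj G b = T b) \<and>
      (\<forall>b\<in>Obj B. \<forall>b'\<in>Obj B. \<forall>h\<in>Hom B b b'. natural_at B C H T \<alpha> b b' h (fmor G b b' h))"
    then show "G = mk_functor B T fm"
      by (intro functor_eqI[of B C, OF _ F])
        (auto intro!: fm_eq[symmetric] dest: is_functorD(2))
  qed (auto simp: fm)
qed

end

text \<open>
  Every \<open>(f, u)\<close> factors as \<open>(f, id) \<circ> (id, u)\<close>, so over a product of categories naturality need
  only be imposed in each variable separately.
\<close>

lemma representing_functor_prod:
  assumes B: "is_category B" and D: "is_category D" and C: "is_category C"
    and H: "is_functor (prod_cat (opposite (prod_cat B D)) C) Set_cat H"
    and T: "\<And>b. b \<in> Obj (prod_cat B D) \<Longrightarrow> T b \<in> Obj C"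
    and \<alpha>: "\<And>b. b \<in> Obj (prod_cat B D) \<Longrightarrow> \<alpha> b \<in> fobj H (b, T b)"
    and univ: "\<And>b y m. \<lbrakk>b \<in> Obj (prod_cat B D); y \<in> Obj C; m \<in> fobj H (b, y)\<rbrakk> \<Longrightarrow>
      \<exists>!g. g \<in> Hom C (T b) y \<and>
        fmor H (b, T b) (b, y) (Ident (prod_cat B D) b, g) (\<alpha> b) = m"
  shows "\<exists>!F. is_functor (prod_cat B D) C F \<and>
    (\<forall>X\<in>Obj B. \<forall>K\<in>Obj D. fobj F (X, K) = T (X, K)) \<and>
    (\<forall>X\<in>Obj B. \<forall>Y\<in>Obj B. \<forall>K\<in>Obj D. \<forall>L\<in>Obj D. \<forall>u\<in>Hom D K L. \<forall>f\<in>Hom B X Y.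
       natural_at (prod_cat B D) C H T \<alpha> (X, K) (X, L) (Ident B X, u)
         (fmor F (X, K) (X, L) (Ident B X, u)) \<and>
       natural_at (prod_cat B D) C H T \<alpha> (X, K) (Y, K) (f, Ident D K)
         (fmor F (X, K) (Y, K) (f, Ident D K)))"
    (is "\<exists>!F. ?P F")
proof -
  note BD = is_category_prod_cat[OF B D]
  let ?N = "natural_at (prod_cat B D) C H T \<alpha>"
  have joint: "?N (X, K) (Y, L) (f, u) (fmor F (X, K) (Y, L) (f, u))"
    if F: "?P F" and o: "X \<in> Obj B" "Y \<in> Obj B" "K \<in> Obj D" "L \<in> Obj D"
      and fu: "f \<in> Hom B X Y" "u \<in> Hom D K L" for F X Y K L f u
  proof -
    have FF: "is_functor (prod_cat B D) C F" using F by blast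
    have fo: "fobj F (X, K) = T (X, K)" "fobj F (X, L) = T (X, L)" "fobj F (Y, L) = T (Y, L)"
      using F o by blast+
    note [simp] = o fu is_categoryD[OF B] is_categoryD[OF D]
    have mem: "fmor F (X, K) (X, L) (Ident B X, u) \<in> Hom C (T (X, K)) (T (X, L))"
      "fmor F (X, L) (Y, L) (f, Ident D L) \<in> Hom C (T (X, L)) (T (Y, L))"
      using is_functorD(2)[OF FF, of "(X, K)" "(X, L)" "(Ident B X, u)"]
        is_functorD(2)[OF FF, of "(X, L)" "(Y, L)" "(f, Ident D L)"] by (simp_all add: fo)
    have n: "?N (X, K) (X, L) (Ident B X, u) (fmor F (X, K) (X, L) (Ident B X, u))"
      "?N (X, L) (Y, L) (f, Ident D L) (fmor F (X, L) (Y, L) (f, Ident D L))"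
      using F o fu is_categoryD(1)[OF D] by blast+
    show ?thesis
      using natural_at_comp[OF BD C H T \<alpha> _ _ _ _ _ mem n]
        is_functorD(4)[OF FF, of "(X, K)" "(X, L)" "(Y, L)" "(Ident B X, u)" "(f, Ident D L)"]
      by (simp add: fo)
  qed
  \<comment> \<open>The separate and the joint condition are equivalent for each \<open>F\<close>,
    so unique existence transfers. The converse puts an identity into one component.\<close>
  have "?P F \<longleftrightarrow> is_functor (prod_cat B D) C F \<and> (\<forall>b\<in>Obj (prod_cat B D). fobj F b = T b) \<and>
    (\<forall>b\<in>Obj (prod_cat B D). \<forall>b'\<in>Obj (prod_cat B D). \<forall>h\<in>Hom (prod_cat B D) b b'.
       ?N b b' h (fmor F b b' h))" (is "_ \<longleftrightarrow> ?Q F") for F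
  proof
    show "?Q F" if "?P F" using joint[OF that] that by simp
    show "?P F" if "?Q F" using that is_categoryD(1)[OF B] is_categoryD(1)[OF D] by simp
  qed
  then show ?thesis
    using representing_functor[OF BD C H T \<alpha> univ] by simp
qed

section \<open>Contravariant representability by reversal\<close>

lemma opposite_opposite [simp]: "opposite (opposite C) = C"
  by (simp add: opposite_def)

lemma opposite_prod_cat: "opposite (prod_cat B D) = prod_cat (opposite B) (opposite D)"
  by (auto simp: opposite_def prod_cat_def fun_eq_iff)

text \<open>The representing functor of the opposite data, \<open>B^op x D^op -> C^op\<close>, is
  reversed into a functor \<open>B x D -> C\<close>. This is why \<open>u\<close> and
  \<open>f\<close> run backwards in the statement, while \<open>natural_at\<close> sees them as
  morphisms out of \<open>(X, K)\<close>.\<close>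

lemma corepresenting_functor_prod:
  assumes B: "is_category B" and D: "is_category D" and C: "is_category C"
    and H: "is_functor (prod_cat (prod_cat B D) (opposite C)) Set_cat H"
    and T: "\<And>b. b \<in> Obj (prod_cat B D) \<Longrightarrow> T b \<in> Obj C"
    and \<alpha>: "\<And>b. b \<in> Obj (prod_cat B D) \<Longrightarrow> \<alpha> b \<in> fobj H (b, T b)"
    and univ: "\<And>b y m. \<lbrakk>b \<in> Obj (prod_cat B D); y \<in> Obj C; m \<in> fobj H (b, y)\<rbrakk> \<Longrightarrow>
      \<exists>!g. g \<in> Hom C y (T b) \<and>
        fmor H (b, T b) (b, y) (Ident (prod_cat B D) b, g) (\<alpha> b) = m"
  shows "\<exists>!F. is_functor (prod_cat B D) C F \<and>
    (\<forall>X\<in>Obj B. \<forall>K\<in>Obj D. fobj F (X, K) = T (X, K)) \<and>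
    (\<forall>X\<in>Obj B. \<forall>Y\<in>Obj B. \<forall>K\<in>Obj D. \<forall>L\<in>Obj D. \<forall>u\<in>Hom D L K. \<forall>f\<in>Hom B Y X.
       natural_at (prod_cat B D) (opposite C) H T \<alpha> (X, K) (X, L) (Ident B X, u)
         (fmor F (X, L) (X, K) (Ident B X, u)) \<and>
       natural_at (prod_cat B D) (opposite C) H T \<alpha> (X, K) (Y, K) (f, Ident D K)
         (fmor F (Y, K) (X, K) (f, Ident D K)))"
    (is "\<exists>!F. ?P F")
proof -
  let ?B = "opposite B" and ?D = "opposite D" and ?C = "opposite C"
  \<comment> \<open>\<open>natural_at\<close> depends on its first category only through the
    identities, which reversal keeps.\<close>
  have N: "natural_at (prod_cat ?B ?D) ?C H T \<alpha> = natural_at (prod_cat B D) ?C H T \<alpha>"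
    by (auto simp: natural_at_def fun_eq_iff)
  have Id: "Ident (prod_cat ?B ?D) = Ident (prod_cat B D)"
    by (auto simp: fun_eq_iff)
  have "\<exists>!F. ?P (opposite_functor F)"
    using representing_functor_prod[OF is_category_opposite[OF B] is_category_opposite[OF D]
        is_category_opposite[OF C], of H T \<alpha>] H T \<alpha> univ
    unfolding is_functor_opposite[of "prod_cat B D" C, symmetric]
    by (simp add: N Id opposite_prod_cat)
  then show ?thesis by (rule ex1_opposite_functor)
qed

subsection \<open>Simplicial sets\<close>

lemma set_nat_iso_bij_betw:
  assumes "\<eta> \<in> set_nat_iso C F G" "X \<in> Obj C"
  shows "bij_betw (\<eta> X) (fobj F X) (fobj G X)"
proof -
  obtain \<epsilon> where \<eta>: "\<eta> \<in> set_nat C F G" and \<epsilon>: "\<epsilon> \<in> set_nat C G F"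
    and eq: "set_nat_comp C F \<epsilon> \<eta> = set_nat_id C F" "set_nat_comp C G \<eta> \<epsilon> = set_nat_id C G"
    using assms(1) unfolding set_nat_iso_def by blast
  have "\<epsilon> X (\<eta> X x) = x" if "x \<in> fobj F X" for x
    using fun_cong[OF fun_cong[OF eq(1), of X], of x] assms(2) that
    by (simp add: set_nat_comp_def set_nat_id_def compose_def)
  moreover have "\<eta> X (\<epsilon> X x) = x" if "x \<in> fobj G X" for x
    using fun_cong[OF fun_cong[OF eq(2), of X], of x] assms(2) that
    by (simp add: set_nat_comp_def set_nat_id_def compose_def)
  moreover have "\<eta> X \<in> fobj F X \<rightarrow> fobj G X" "\<epsilon> X \<in> fobj G X \<rightarrow> fobj F X"
    using \<eta> \<epsilon> assms(2) unfolding set_nat_def by (fastforce simp: PiE_iff)+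
  ultimately show ?thesis
    by (intro bij_betw_byWitness[where f' = "\<epsilon> X"]) auto
qed

section \<open>The simplex category and maps of simplicial sets\<close>

lemma Delta_simps [simp]:
  "Obj Delta = UNIV" "Ident Delta n = (\<lambda>i\<in>{..n}. i)"
  "Cmp Delta k m n \<theta> \<eta> = compose {..k} \<theta> \<eta>"
  by (simp_all add: Delta_def)

lemma Hom_Delta_iff: "\<theta> \<in> Hom Delta m n \<longleftrightarrow> \<theta> \<in> {..m} \<rightarrow>\<^sub>E {..n} \<and> mono_on {..m} \<theta>"
  by (simp add: Delta_def)

lemma is_category_Delta: "is_category Delta"
  unfolding is_category_def
  by (auto simp: Hom_Delta_iff PiE_iff mono_on_def compose_def extensional_def fun_eq_iff)

lemma smap_iff:
  "u \<in> smap K L \<longleftrightarrow> (\<forall>n. u n \<in> fobj K n \<rightarrow>\<^sub>E fobj L n) \<and>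
     (\<forall>n m \<theta> x. \<theta> \<in> Hom Delta m n \<longrightarrow> x \<in> fobj K n \<longrightarrow> u m (fmor K n m \<theta> x) = fmor L n m \<theta> (u n x))"
  by (auto simp: smap_def set_nat_def PiE_iff)

lemma smap_mem: "u \<in> smap K L \<Longrightarrow> x \<in> fobj K n \<Longrightarrow> u n x \<in> fobj L n"
  by (auto simp: smap_iff PiE_iff)

lemma smap_natural:
  "u \<in> smap K L \<Longrightarrow> \<theta> \<in> Hom Delta m n \<Longrightarrow> x \<in> fobj K n \<Longrightarrow>
     u m (fmor K n m \<theta> x) = fmor L n m \<theta> (u n x)"
  by (simp add: smap_iff)

lemma smap_eqI:
  assumes "u \<in> smap K L" "v \<in> smap K L'" "\<And>n x. x \<in> fobj K n \<Longrightarrow> u n x = v n x"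
  shows "u = v"
proof
  show "u n = v n" for n
    using assms by (intro extensionalityI[of _ "fobj K n"]) (auto simp: smap_iff PiE_iff)
qed

lemma scmp_apply: "x \<in> fobj K n \<Longrightarrow> scmp K v u n x = v n (u n x)"
  by (simp add: scmp_def set_nat_comp_def compose_def)

lemma sid_apply: "x \<in> fobj K n \<Longrightarrow> sid K n x = x"
  by (simp add: sid_def set_nat_id_def)

lemma sset_mem:
  "K \<in> Obj sSet \<Longrightarrow> \<theta> \<in> Hom Delta m n \<Longrightarrow> x \<in> fobj K n \<Longrightarrow> fmor K n m \<theta> x \<in> fobj K m"
  by (auto simp: sSet_def dest!: is_functorD(2)[of _ _ _ n m \<theta>] dest: PiE_mem)

lemma scmp_smap:
  assumes K: "K \<in> Obj sSet" and u: "u \<in> smap K L" and v: "v \<in> smap L M"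
  shows "scmp K v u \<in> smap K M"
  unfolding smap_iff
proof (intro conjI allI impI)
  show "scmp K v u n \<in> fobj K n \<rightarrow>\<^sub>E fobj M n" for n
    using smap_mem[OF u] smap_mem[OF v]
    by (auto simp: scmp_def set_nat_comp_def compose_def)
next
  fix n m \<theta> x
  assume "\<theta> \<in> Hom Delta m n" "x \<in> fobj K n"
  then show "scmp K v u m (fmor K n m \<theta> x) = fmor M n m \<theta> (scmp K v u n x)"
    by (simp add: scmp_apply sset_mem[OF K] smap_natural[OF u] smap_natural[OF v] smap_mem[OF u])
qed

lemma sid_smap: "K \<in> Obj sSet \<Longrightarrow> sid K \<in> smap K K"
  by (auto simp: smap_iff sid_def set_nat_id_def intro: sset_mem)

lemma scmp_assoc:
  assumes "u \<in> smap K L"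
  shows "scmp K (scmp L w v) u = scmp K w (scmp K v u)"
  using smap_mem[OF assms] by (auto simp: scmp_def set_nat_comp_def compose_def fun_eq_iff restrict_def)

lemma scmp_sid:
  assumes "u \<in> smap K L"
  shows "scmp K u (sid K) = u" "scmp K (sid L) u = u"
  using assms
  by (auto simp: smap_iff PiE_iff extensional_def scmp_def set_nat_comp_def compose_def
      sid_def set_nat_id_def fun_eq_iff restrict_def)

lemma sSet_simps [simp]:
  "Hom sSet K L = smap K L" "Ident sSet K = sid K" "Cmp sSet K L M v u = scmp K v u"
  by (simp_all add: sSet_def)

lemma is_category_sSet: "is_category sSet"
  unfolding is_category_def by (auto simp: sid_smap scmp_smap scmp_sid scmp_assoc)

text \<open>The functor \<open>e \<mapsto> sSet(\<kappa> e, \<gamma> e)\<close>, contravariant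
  through \<open>\<kappa>\<close> and covariant through \<open>\<gamma>\<close>. The families are
  plain functions on \<open>E\<close>, so that components of nested pairs can be put in for them;
  the cylinder and the path functor are both instances.\<close>

lemma is_functor_smap:
  assumes E: "is_category E"
    and \<kappa>: "\<And>e. e \<in> Obj E \<Longrightarrow> \<kappa> e \<in> Obj sSet"
    and k: "\<And>e e' t. \<lbrakk>e \<in> Obj E; e' \<in> Obj E; t \<in> Hom E e e'\<rbrakk> \<Longrightarrow> k e e' t \<in> smap (\<kappa> e') (\<kappa> e)"
    and g: "\<And>e e' t. \<lbrakk>e \<in> Obj E; e' \<in> Obj E; t \<in> Hom E e e'\<rbrakk> \<Longrightarrow> g e e' t \<in> smap (\<gamma> e) (\<gamma> e')"
    and id: "\<And>e. e \<in> Obj E \<Longrightarrow> k e e (Ident E e) = sid (\<kappa> e) \<and> g e e (Ident E e) = sid (\<gamma> e)"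
    and comp: "\<And>e e' e'' s t. \<lbrakk>e \<in> Obj E; e' \<in> Obj E; e'' \<in> Obj E; s \<in> Hom E e e'; t \<in> Hom E e' e''\<rbrakk> \<Longrightarrow>
       k e e'' (Cmp E e e' e'' t s) = scmp (\<kappa> e'') (k e e' s) (k e' e'' t) \<and>
       g e e'' (Cmp E e e' e'' t s) = scmp (\<gamma> e) (g e' e'' t) (g e e' s)"
  shows "is_functor E Set_cat
    (mk_functor E (\<lambda>e. smap (\<kappa> e) (\<gamma> e))
       (\<lambda>e e' t. \<lambda>m\<in>smap (\<kappa> e) (\<gamma> e). scmp (\<kappa> e') (g e e' t) (scmp (\<kappa> e') m (k e e' t))))"
proof (rule is_functor_mk_functor[OF E], goal_cases)
  case (2 e e' t)
  then show ?case
    using k[OF 2] g[OF 2] \<kappa> by (auto intro!: scmp_smap)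
next
  case (3 e)
  then show ?case
    by (auto simp: id scmp_sid intro!: restrict_ext)
next
  case (4 e e' e'' s t)
  note st = 4
  have ks: "k e e' s \<in> smap (\<kappa> e') (\<kappa> e)" and kt: "k e' e'' t \<in> smap (\<kappa> e'') (\<kappa> e')"
    and gs: "g e e' s \<in> smap (\<gamma> e) (\<gamma> e')" and gt: "g e' e'' t \<in> smap (\<gamma> e') (\<gamma> e'')"
    using st by (simp_all add: k g)
  let ?M = "smap (\<kappa> e) (\<gamma> e)" and ?M' = "smap (\<kappa> e') (\<gamma> e')"
  let ?f = "\<lambda>m. scmp (\<kappa> e') (g e e' s) (scmp (\<kappa> e') m (k e e' s))"
  let ?f' = "\<lambda>m. scmp (\<kappa> e'') (g e' e'' t) (scmp (\<kappa> e'') m (k e' e'' t))"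
  have f: "?f m \<in> ?M'" if "m \<in> ?M" for m
    using st ks gs that \<kappa> by (auto intro!: scmp_smap)
  have "scmp (\<kappa> e'') (scmp (\<gamma> e) (g e' e'' t) (g e e' s))
      (scmp (\<kappa> e'') m (scmp (\<kappa> e'') (k e e' s) (k e' e'' t))) = ?f' (?f m)"
    if m: "m \<in> ?M" for m
    using smap_mem[OF ks] smap_mem[OF kt] smap_mem[OF gs] smap_mem[OF gt] smap_mem[OF m]
    by (auto simp: scmp_def set_nat_comp_def compose_def fun_eq_iff restrict_def)
  with f show ?case
    by (auto simp: comp[OF st] compose_def intro!: restrict_ext)
qed simp

section \<open>Products, standard simplices and internal homs\<close>

lemma fobj_sprod [simp]: "fobj (sprod K L) n = fobj K n \<times> fobj L n"
  by (simp add: sprod_def)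

lemma fmor_sprod:
  "\<theta> \<in> Hom Delta m n \<Longrightarrow> a \<in> fobj K n \<Longrightarrow> b \<in> fobj L n \<Longrightarrow>
     fmor (sprod K L) n m \<theta> (a, b) = (fmor K n m \<theta> a, fmor L n m \<theta> b)"
  by (simp add: sprod_def)

lemma fobj_simplex [simp]: "fobj (simplex n) k = Hom Delta k n"
  by (simp add: simplex_def)

lemma fmor_simplex:
  "\<eta> \<in> Hom Delta k l \<Longrightarrow> \<alpha> \<in> Hom Delta l n \<Longrightarrow> fmor (simplex n) l k \<eta> \<alpha> = compose {..k} \<alpha> \<eta>"
  by (simp add: simplex_def)

lemma fobj_ihom [simp]: "fobj (ihom A B) n = smap (sprod A (simplex n)) B"
  by (simp add: ihom_def)

lemma Delta_Ident: "(\<lambda>i\<in>{..n}. i) \<in> Hom Delta n n"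
  using is_categoryD(1)[OF is_category_Delta, of n] by simp

text \<open>A Yoneda argument: precomposition with \<open>id x \<Delta>[\<theta>]\<close> sends the
  identity simplex of \<open>\<Delta>[m]\<close> to \<open>\<theta>\<close>. Thus evaluation at
  identities, which is all that \<open>ev\<close> sees, reaches the values of \<open>f\<close> at
  every simplex of \<open>\<Delta>[n]\<close>.\<close>

lemma fmor_ihom_apply:
  assumes "\<theta> \<in> Hom Delta m n" "f \<in> smap (sprod A (simplex n)) B" "a \<in> fobj A m"
  shows "fmor (ihom A B) n m \<theta> f m (a, \<lambda>i\<in>{..m}. i) = f m (a, \<theta>)"
proof -
  have "compose {..m} \<theta> (\<lambda>i\<in>{..m}. i) = \<theta>"
    using is_categoryD(3)[OF is_category_Delta, of m n \<theta>] assms(1) by simp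
  then show ?thesis
    using assms Delta_Ident
    by (simp add: ihom_def scmp_apply sprod_map_def simplex_map_def sid_apply)
qed

text \<open>Terminality of \<open>[0]\<close>: the factor \<open>\<Delta>[0]\<close> adds nothing to
  the simplices of \<open>K \<times> \<Delta>[0]\<close>.\<close>

lemma Hom_Delta_0: "Hom Delta n 0 = {\<lambda>i\<in>{..n}. 0}"
  by (auto simp: Hom_Delta_iff PiE_iff extensional_def fun_eq_iff mono_on_def)

text \<open>
  The vertices of \<open>ihom K B\<close> are the maps \<open>K \<times> \<Delta>[0] \<rightarrow> B\<close>, i.e. the maps \<open>K \<rightarrow> B\<close>. Naturality
  of \<open>\<phi>\<close> along \<open>[n] \<rightarrow> [0]\<close> recovers \<open>\<phi>\<close> on vertices from the evaluations \<open>c\<close>.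
\<close>

lemma smap_ex1_vertex:
  assumes \<phi>: "\<phi> \<in> siso A (ihom K B)" and A: "A \<in> Obj sSet"
    and c: "\<And>n k s. k \<in> fobj K n \<Longrightarrow> s \<in> fobj A n \<Longrightarrow> \<phi> n s n (k, \<lambda>i\<in>{..n}. i) = c n k s"
    and v: "v \<in> smap K B" and K: "K \<in> Obj sSet"
  shows "\<exists>!s. s \<in> fobj A 0 \<and> (\<forall>n. \<forall>k\<in>fobj K n. c n k (fmor A 0 n (\<lambda>i\<in>{..n}. 0) s) = v n k)"
proof -
  let ?\<sigma> = "\<lambda>n. \<lambda>i\<in>{..n}. (0::nat)"
  have \<sigma>: "?\<sigma> n \<in> Hom Delta n 0" for n by (simp add: Hom_Delta_0)
  have \<phi>s: "\<phi> \<in> smap A (ihom K B)"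
    using \<phi> by (simp add: siso_def smap_def set_nat_iso_def)
  have bij: "bij_betw (\<phi> 0) (fobj A 0) (smap (sprod K (simplex 0)) B)"
    using set_nat_iso_bij_betw[of \<phi> "opposite Delta" A "ihom K B" 0] \<phi> by (simp add: siso_def)
  have \<phi>0: "\<phi> 0 s \<in> smap (sprod K (simplex 0)) B" if "s \<in> fobj A 0" for s
    using smap_mem[OF \<phi>s that] by simp
  \<comment> \<open>The value of \<open>\<phi> 0 s\<close> at \<open>(k, ?\<sigma> n)\<close> is
    that of its pullback along \<open>?\<sigma> n\<close> at the identity simplex. Naturality makes
    this pullback the image under \<open>\<phi> n\<close> of the degenerate simplex on
    \<open>s\<close>, where \<open>c\<close> applies.\<close>
  have val: "\<phi> 0 s n (k, ?\<sigma> n) = c n k (fmor A 0 n (?\<sigma> n) s)"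
    if "s \<in> fobj A 0" "k \<in> fobj K n" for s n k
    using c[OF that(2) sset_mem[OF A \<sigma> that(1)]] smap_natural[OF \<phi>s \<sigma> that(1)]
      fmor_ihom_apply[OF \<sigma> \<phi>0[OF that(1)] that(2)] by simp
  \<comment> \<open>\<open>v\<close> precomposed with the projection from
    \<open>K \<times> \<Delta>[0]\<close>; its preimage under the bijection \<open>\<phi> 0\<close>
    is the vertex sought.\<close>
  let ?w = "\<lambda>n. \<lambda>(k, \<theta>)\<in>fobj K n \<times> Hom Delta n 0. v n k"
  have "?w \<in> smap (sprod K (simplex 0)) B"
    unfolding smap_iff
  proof (intro conjI allI impI)
    show "?w n \<in> fobj (sprod K (simplex 0)) n \<rightarrow>\<^sub>E fobj B n" for n
      using smap_mem[OF v] by auto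
  next
    fix n m \<theta> x
    assume \<theta>: "\<theta> \<in> Hom Delta m n" and "x \<in> fobj (sprod K (simplex 0)) n"
    then obtain k \<eta> where x: "x = (k, \<eta>)" "k \<in> fobj K n" "\<eta> \<in> Hom Delta n 0" by auto
    have "compose {..m} \<eta> \<theta> \<in> Hom Delta m 0"
      using is_categoryD(2)[OF is_category_Delta, of m n 0 \<theta> \<eta>] \<theta> x by simp
    then show "?w m (fmor (sprod K (simplex 0)) n m \<theta> x) = fmor B n m \<theta> (?w n x)"
      using \<theta> x by (simp add: fmor_sprod fmor_simplex sset_mem[OF K] smap_natural[OF v])
  qed
  then obtain s where s: "s \<in> fobj A 0" "\<phi> 0 s = ?w"
    using bij by (metis (no_types, lifting) bij_betw_def imageE)
  show ?thesis
  proof (rule ex1I[of _ s], intro conjI allI ballI)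
    show "s \<in> fobj A 0" by (fact s)
    show "c n k (fmor A 0 n (?\<sigma> n) s) = v n k" if "k \<in> fobj K n" for n k
      using val[OF s(1) that] s(2) that \<sigma> by simp
    fix t
    assume t: "t \<in> fobj A 0 \<and> (\<forall>n. \<forall>k\<in>fobj K n. c n k (fmor A 0 n (?\<sigma> n) t) = v n k)"
    \<comment> \<open>\<open>?\<sigma> n\<close> is the only \<open>n\<close>-simplex of
      \<open>\<Delta>[0]\<close>, so \<open>val\<close> covers every argument.\<close>
    have "\<phi> 0 t = \<phi> 0 s"
    proof (rule smap_eqI)
      show "\<phi> 0 t \<in> smap (sprod K (simplex 0)) B" "\<phi> 0 s \<in> smap (sprod K (simplex 0)) B"
        using t s \<phi>0 by blast+
      show "\<phi> 0 t n x = \<phi> 0 s n x" if "x \<in> fobj (sprod K (simplex 0)) n" for n x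
        using that t val[of t] s by (auto simp: Hom_Delta_0)
    qed
    then show "t = s"
      using bij t s(1) by (auto simp: bij_betw_def dest: inj_onD)
  qed
qed

lemma scmp_eq_iff:
  assumes "K \<in> Obj sSet" "u \<in> smap K L" "w \<in> smap L M" "v \<in> smap K M"
  shows "scmp K w u = v \<longleftrightarrow> (\<forall>n. \<forall>k\<in>fobj K n. w n (u n k) = v n k)"
  using smap_eqI[OF scmp_smap[OF assms(1-3)] assms(4)] by (auto simp: scmp_apply)

text \<open>The left side of the evaluation formula has the same form for cylinders and paths, so it
  is unfolded once for both.\<close>

lemma ev_apply:
  assumes "\<phi> \<in> siso A (ihom K B)" "k \<in> fobj K n" "s \<in> fobj A n"
  shows "scmp (sprod K A) (ev K B) (sprod_map K A (sid K) \<phi>) n (k, s) = \<phi> n s n (k, \<lambda>i\<in>{..n}. i)"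
proof -
  have "\<phi> \<in> smap A (ihom K B)"
    using assms(1) by (simp add: siso_def smap_def set_nat_iso_def)
  from smap_mem[OF this assms(3)] show ?thesis
    using assms(2,3) by (simp add: scmp_apply sprod_map_def ev_def sid_apply)
qed

subsection \<open>Cylinders and paths\<close>

context
  fixes S :: "('o, 'm, 's) scategory"
  assumes S: "is_scategory S"
begin

lemma is_category_und: "is_category (und S)"
  and is_functor_shom: "is_functor (prod_cat (opposite (und S)) (und S)) sSet (shom S)"
  and tld_iso: "tld S \<in> set_nat_iso (prod_cat (opposite (und S)) (und S)) (hom_functor (und S)) (vertices S)"
  using S unfolding is_scategory_def by blast+

lemma shom_sset: "X \<in> Obj (und S) \<Longrightarrow> Y \<in> Obj (und S) \<Longrightarrow> SH S X Y \<in> Obj sSet"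
  using is_functorD(1)[OF is_functor_shom, of "(X, Y)"] by simp

lemma shom_smap:
  assumes "X \<in> Obj (und S)" "Y \<in> Obj (und S)" "X' \<in> Obj (und S)" "Y' \<in> Obj (und S)"
    and "f \<in> Hom (und S) X' X" "g \<in> Hom (und S) Y Y'"
  shows "fmor (shom S) (X, Y) (X', Y') (f, g) \<in> smap (SH S X Y) (SH S X' Y')"
  using is_functorD(2)[OF is_functor_shom, of "(X, Y)" "(X', Y')" "(f, g)"] assms by simp

lemma shom_Ident:
  "X \<in> Obj (und S) \<Longrightarrow> Y \<in> Obj (und S) \<Longrightarrow>
    fmor (shom S) (X, Y) (X, Y) (Ident (und S) X, Ident (und S) Y) = sid (SH S X Y)"
  using is_functorD(3)[OF is_functor_shom, of "(X, Y)"] by simp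

lemma shom_comp:
  assumes "X \<in> Obj (und S)" "Y \<in> Obj (und S)" "X' \<in> Obj (und S)" "Y' \<in> Obj (und S)"
    and "X'' \<in> Obj (und S)" "Y'' \<in> Obj (und S)"
    and "f \<in> Hom (und S) X' X" "g \<in> Hom (und S) Y Y'"
    and "f' \<in> Hom (und S) X'' X'" "g' \<in> Hom (und S) Y' Y''"
  shows "fmor (shom S) (X, Y) (X'', Y'') (Cmp (und S) X'' X' X f f', Cmp (und S) Y Y' Y'' g' g)
    = scmp (SH S X Y) (fmor (shom S) (X', Y') (X'', Y'') (f', g'))
        (fmor (shom S) (X, Y) (X', Y') (f, g))"
  using is_functorD(4)[OF is_functor_shom, of "(X, Y)" "(X', Y')" "(X'', Y'')" "(f, g)" "(f', g')"]
    assms by simp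

lemma post_smap:
  assumes "X \<in> Obj (und S)" "Y \<in> Obj (und S)" "Z \<in> Obj (und S)" "g \<in> Hom (und S) Y Z"
  shows "post S X Y Z g \<in> smap (SH S X Y) (SH S X Z)"
  unfolding post_def using assms is_categoryD(1)[OF is_category_und] by (intro shom_smap) auto

lemma pre_smap:
  assumes "X \<in> Obj (und S)" "Y \<in> Obj (und S)" "Z \<in> Obj (und S)" "f \<in> Hom (und S) X Y"
  shows "pre S X Y Z f \<in> smap (SH S Y Z) (SH S X Z)"
  unfolding pre_def using assms is_categoryD(1)[OF is_category_und] by (intro shom_smap) auto

lemma post_apply:
  assumes "X \<in> Obj (und S)" "Y \<in> Obj (und S)" "Z \<in> Obj (und S)"
    and "f \<in> fobj (SH S X Y) n" "g \<in> Hom (und S) Y Z"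
  shows "post S X Y Z g n f
    = bul S X Y Z n (f, fmor (SH S Y Z) 0 n (\<lambda>i\<in>{..n}. 0) (tld S (Y, Z) g))"
  using S assms unfolding is_scategory_def degen_def by blast

lemma pre_apply:
  assumes "X \<in> Obj (und S)" "Y \<in> Obj (und S)" "Z \<in> Obj (und S)"
    and "f \<in> Hom (und S) X Y" "g \<in> fobj (SH S Y Z) n"
  shows "pre S X Y Z f n g
    = bul S X Y Z n (fmor (SH S X Y) 0 n (\<lambda>i\<in>{..n}. 0) (tld S (X, Y) f), g)"
  using S assms unfolding is_scategory_def degen_def by blast

lemma tld_bij_betw:
  assumes "X \<in> Obj (und S)" "Y \<in> Obj (und S)"
  shows "bij_betw (tld S (X, Y)) (Hom (und S) X Y) (fobj (SH S X Y) 0)"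
  using set_nat_iso_bij_betw[OF tld_iso, of "(X, Y)"] assms
  by (simp add: hom_functor_def vertices_def)

text \<open>By (S3) morphisms are the vertices of the simplicial hom, so unique existence moves
  along the bijection \<open>tld\<close>; \<open>PQ\<close> rewrites the condition on a vertex into
  one on its morphism.\<close>

lemma Hom_ex1_of_vertex_ex1:
  assumes "X \<in> Obj (und S)" "Y \<in> Obj (und S)"
    and ex1: "\<exists>!s. s \<in> fobj (SH S X Y) 0 \<and> P s"
    and PQ: "\<And>g. g \<in> Hom (und S) X Y \<Longrightarrow> P (tld S (X, Y) g) \<longleftrightarrow> Q g"
  shows "\<exists>!g. g \<in> Hom (und S) X Y \<and> Q g"
proof -
  note bij = tld_bij_betw[OF assms(1,2)]
  obtain s where s: "s \<in> fobj (SH S X Y) 0" "P s"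
    and uniq: "\<And>t. t \<in> fobj (SH S X Y) 0 \<Longrightarrow> P t \<Longrightarrow> t = s"
    using ex1 by blast
  obtain g where g: "g \<in> Hom (und S) X Y" "tld S (X, Y) g = s"
    using s(1) bij_betw_imp_surj_on[OF bij] by (metis imageE)
  show ?thesis
  proof (rule ex1I[of _ g])
    show "g \<in> Hom (und S) X Y \<and> Q g" using g s PQ[OF g(1)] by simp
    fix h assume h: "h \<in> Hom (und S) X Y \<and> Q h"
    then have "tld S (X, Y) h = s"
      using PQ[of h] by (intro uniq bij_betwE[OF bij, rule_format]) simp_all
    with h g show "h = g"
      using inj_onD[OF bij_betw_imp_inj_on[OF bij]] by simp
  qed
qed

text \<open>The evaluation formula supplies the values \<open>c\<close> that
  \<open>smap_ex1_vertex\<close> asks for, and (S5) converts composition with the degenerate vertex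
  of \<open>g\<close> into \<open>post\<close>.\<close>

lemma cylinder_universal:
  assumes cyl: "is_cylinder S K X (T, \<alpha>, \<phi>)" and K: "K \<in> Obj sSet"
    and X: "X \<in> Obj (und S)" and Y: "Y \<in> Obj (und S)" and v: "v \<in> smap K (SH S X Y)"
  shows "\<exists>!g. g \<in> Hom (und S) T Y \<and> scmp K (post S X T Y g) \<alpha> = v"
proof -
  have T: "T \<in> Obj (und S)" and \<alpha>: "\<alpha> \<in> smap K (SH S X T)"
    and \<phi>: "\<phi> Y \<in> siso (SH S T Y) (ihom K (SH S X Y))"
    and ev: "scmp (sprod K (SH S T Y)) (ev K (SH S X Y)) (sprod_map K (SH S T Y) (sid K) (\<phi> Y))
          = scmp (sprod K (SH S T Y)) (bul S X T Y) (sprod_map K (SH S T Y) \<alpha> (sid (SH S T Y)))"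
    using cyl Y unfolding is_cylinder_def by auto
  have c: "\<phi> Y n s n (k, \<lambda>i\<in>{..n}. i) = bul S X T Y n (\<alpha> n k, s)"
    if "k \<in> fobj K n" "s \<in> fobj (SH S T Y) n" for n k s
    using ev_apply[OF \<phi> that, unfolded ev] that
    by (simp add: scmp_apply sprod_map_def sid_apply)
  show ?thesis
  proof (rule Hom_ex1_of_vertex_ex1[OF T Y smap_ex1_vertex[OF \<phi> shom_sset[OF T Y] c v K]])
    fix g assume g: "g \<in> Hom (und S) T Y"
    show "(\<forall>n. \<forall>k\<in>fobj K n. bul S X T Y n
          (\<alpha> n k, fmor (SH S T Y) 0 n (\<lambda>i\<in>{..n}. 0) (tld S (T, Y) g)) = v n k)
        \<longleftrightarrow> scmp K (post S X T Y g) \<alpha> = v"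
      by (simp add: scmp_eq_iff[OF K \<alpha> post_smap[OF X T Y g] v]
          post_apply[OF X T Y smap_mem[OF \<alpha>] g])
  qed
qed

text \<open>The arguments of \<open>bul\<close> trade places: the vertex of \<open>g\<close> is
  composed before \<open>\<beta>\<close>, so the other half of (S5) applies and \<open>pre\<close>
  appears. The pairing of projections in the path formula is this swap of factors.\<close>

lemma path_universal:
  assumes path: "is_path S K X (P, \<beta>, \<psi>)" and K: "K \<in> Obj sSet"
    and X: "X \<in> Obj (und S)" and Y: "Y \<in> Obj (und S)" and v: "v \<in> smap K (SH S Y X)"
  shows "\<exists>!g. g \<in> Hom (und S) Y P \<and> scmp K (pre S Y P X g) \<beta> = v"
proof -
  have P: "P \<in> Obj (und S)" and \<beta>: "\<beta> \<in> smap K (SH S P X)"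
    and \<psi>: "\<psi> Y \<in> siso (SH S Y P) (ihom K (SH S Y X))"
    and ev: "scmp (sprod K (SH S Y P)) (ev K (SH S Y X)) (sprod_map K (SH S Y P) (sid K) (\<psi> Y))
          = scmp (sprod K (SH S Y P)) (bul S Y P X)
              (spair (sprod K (SH S Y P)) (spr2 K (SH S Y P))
                 (scmp (sprod K (SH S Y P)) \<beta> (spr1 K (SH S Y P))))"
    using path Y unfolding is_path_def by auto
  have c: "\<psi> Y n s n (k, \<lambda>i\<in>{..n}. i) = bul S Y P X n (s, \<beta> n k)"
    if "k \<in> fobj K n" "s \<in> fobj (SH S Y P) n" for n k s
    using ev_apply[OF \<psi> that, unfolded ev] that
    by (simp add: scmp_apply spair_def spr1_def spr2_def)
  show ?thesis
  proof (rule Hom_ex1_of_vertex_ex1[OF Y P smap_ex1_vertex[OF \<psi> shom_sset[OF Y P] c v K]])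
    fix g assume g: "g \<in> Hom (und S) Y P"
    show "(\<forall>n. \<forall>k\<in>fobj K n. bul S Y P X n
          (fmor (SH S Y P) 0 n (\<lambda>i\<in>{..n}. 0) (tld S (Y, P) g), \<beta> n k) = v n k)
        \<longleftrightarrow> scmp K (pre S Y P X g) \<beta> = v"
      by (simp add: scmp_eq_iff[OF K \<beta> pre_smap[OF Y P X g] v]
          pre_apply[OF Y P X g smap_mem[OF \<beta>]])
  qed
qed

text \<open>The functor \<open>((X, K), Y) \<mapsto> sSet(K, S(X, Y))\<close>. Projections in place
  of patterns let its body match \<open>is_functor_smap\<close> directly; \<open>X\<close> and
  \<open>K\<close> form the contravariant parameter of
  \<open>representing_functor_prod\<close>.\<close>

definition cylinder_functor ::
  "(('o \<times> 'k sset) \<times> 'o, ('m \<times> (nat \<Rightarrow> 'k \<Rightarrow> 'k)) \<times> 'm,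
    (nat \<Rightarrow> 'k \<Rightarrow> 's) set, (nat \<Rightarrow> 'k \<Rightarrow> 's) \<Rightarrow> (nat \<Rightarrow> 'k \<Rightarrow> 's)) fctor" where
  "cylinder_functor =
     mk_functor (prod_cat (opposite (prod_cat (und S) sSet)) (und S))
       (\<lambda>e. smap (snd (fst e)) (SH S (fst (fst e)) (snd e)))
       (\<lambda>e e' t. \<lambda>m\<in>smap (snd (fst e)) (SH S (fst (fst e)) (snd e)).
          scmp (snd (fst e'))
            (fmor (shom S) (fst (fst e), snd e) (fst (fst e'), snd e') (fst (fst t), snd t))
            (scmp (snd (fst e')) m (snd (fst t))))"

text \<open>The functor \<open>((X, K), Y) \<mapsto> sSet(K, S(Y, X))\<close>. Now \<open>X\<close>
  is covariant and \<open>Y\<close> contravariant; \<open>K\<close> stays contravariant and enters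
  through \<open>opposite sSet\<close>, which gives the form of
  \<open>corepresenting_functor_prod\<close>.\<close>

definition path_functor ::
  "(('o \<times> 'k sset) \<times> 'o, ('m \<times> (nat \<Rightarrow> 'k \<Rightarrow> 'k)) \<times> 'm,
    (nat \<Rightarrow> 'k \<Rightarrow> 's) set, (nat \<Rightarrow> 'k \<Rightarrow> 's) \<Rightarrow> (nat \<Rightarrow> 'k \<Rightarrow> 's)) fctor" where
  "path_functor =
     mk_functor (prod_cat (prod_cat (und S) (opposite sSet)) (opposite (und S)))
       (\<lambda>e. smap (snd (fst e)) (SH S (snd e) (fst (fst e))))
       (\<lambda>e e' t. \<lambda>m\<in>smap (snd (fst e)) (SH S (snd e) (fst (fst e))).
          scmp (snd (fst e'))
            (fmor (shom S) (snd e, fst (fst e)) (snd e', fst (fst e')) (snd t, fst (fst t)))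
            (scmp (snd (fst e')) m (snd (fst t))))"

lemma is_functor_cylinder_functor:
  "is_functor (prod_cat (opposite (prod_cat (und S) sSet)) (und S)) Set_cat cylinder_functor"
  unfolding cylinder_functor_def
  by (rule is_functor_smap)
    (auto intro: is_category_prod_cat is_category_opposite is_category_und is_category_sSet shom_smap
      simp: shom_Ident shom_comp)

lemma is_functor_path_functor:
  "is_functor (prod_cat (prod_cat (und S) (opposite sSet)) (opposite (und S))) Set_cat path_functor"
  unfolding path_functor_def
  by (rule is_functor_smap)
    (auto intro: is_category_prod_cat is_category_opposite is_category_und is_category_sSet shom_smap
      simp: shom_Ident shom_comp)

lemma cylinder_functor_simps:
  assumes "X \<in> Obj (und S)" "Y \<in> Obj (und S)" "X' \<in> Obj (und S)" "Y' \<in> Obj (und S)"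
    and "K \<in> Obj sSet" "K' \<in> Obj sSet"
  shows "fobj cylinder_functor ((X, K), Y) = smap K (SH S X Y)"
    and "f \<in> Hom (und S) X' X \<Longrightarrow> u \<in> smap K' K \<Longrightarrow> g \<in> Hom (und S) Y Y' \<Longrightarrow>
      m \<in> smap K (SH S X Y) \<Longrightarrow>
      fmor cylinder_functor ((X, K), Y) ((X', K'), Y') ((f, u), g) m
        = scmp K' (fmor (shom S) (X, Y) (X', Y') (f, g)) (scmp K' m u)"
  using assms by (simp_all add: cylinder_functor_def)

lemma path_functor_simps:
  assumes "X \<in> Obj (und S)" "Y \<in> Obj (und S)" "X' \<in> Obj (und S)" "Y' \<in> Obj (und S)"
    and "K \<in> Obj sSet" "K' \<in> Obj sSet"
  shows "fobj path_functor ((X, K), Y) = smap K (SH S Y X)"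
    and "f \<in> Hom (und S) X X' \<Longrightarrow> u \<in> smap K' K \<Longrightarrow> g \<in> Hom (und S) Y' Y \<Longrightarrow>
      m \<in> smap K (SH S Y X) \<Longrightarrow>
      fmor path_functor ((X, K), Y) ((X', K'), Y') ((f, u), g) m
        = scmp K' (fmor (shom S) (Y, X) (Y', X') (g, f)) (scmp K' m u)"
  using assms by (simp_all add: path_functor_def)

end

section \<open>From naturality to the equations in (b)\<close>

theorem theorem1p3:
  fixes S :: "('o, 'm, 's) scategory"
  assumes "is_scategory S"
    and "\<forall>X\<in>Obj (und S). \<forall>K\<in>Obj (sSet :: ('k sset, nat \<Rightarrow> 'k \<Rightarrow> 'k) category).
           (\<exists>c. is_cylinder S K X c) \<and> (\<exists>p. is_path S K X p)"
  shows
    "(\<forall>T \<alpha> \<phi>.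
        (\<forall>X\<in>Obj (und S). \<forall>K\<in>Obj (sSet :: ('k sset, nat \<Rightarrow> 'k \<Rightarrow> 'k) category).
           is_cylinder S K X (T X K, \<alpha> K X, \<phi> K X)) \<longrightarrow>
        (\<exists>!F. is_functor (prod_cat (und S) (sSet :: ('k sset, nat \<Rightarrow> 'k \<Rightarrow> 'k) category)) (und S) F \<and>
           (\<forall>X\<in>Obj (und S). \<forall>K\<in>Obj sSet. fobj F (X, K) = T X K) \<and>
           (\<forall>X\<in>Obj (und S). \<forall>Y\<in>Obj (und S). \<forall>K\<in>Obj sSet. \<forall>L\<in>Obj sSet.
              \<forall>u\<in>Hom sSet K L. \<forall>f\<in>Hom (und S) X Y.
              scmp K (post S X (T X K) (T X L) (fmor F (X, K) (X, L) (Ident (und S) X, u))) (\<alpha> K X)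
                = scmp K (\<alpha> L X) u \<and>
              scmp K (post S X (T X K) (T Y K) (fmor F (X, K) (Y, K) (f, Ident sSet K))) (\<alpha> K X)
                = scmp K (pre S X Y (T Y K) f) (\<alpha> K Y))))
     \<and>
     (\<forall>P \<beta> \<psi>.
        (\<forall>X\<in>Obj (und S). \<forall>K\<in>Obj (sSet :: ('k sset, nat \<Rightarrow> 'k \<Rightarrow> 'k) category).
           is_path S K X (P X K, \<beta> K X, \<lambda>Y. \<psi> K Y X)) \<longrightarrow>
        (\<exists>!F. is_functor
                (prod_cat (und S) (opposite (sSet :: ('k sset, nat \<Rightarrow> 'k \<Rightarrow> 'k) category))) (und S) F \<and>
           (\<forall>X\<in>Obj (und S). \<forall>K\<in>Obj sSet. fobj F (X, K) = P X K) \<and>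
           (\<forall>X\<in>Obj (und S). \<forall>Y\<in>Obj (und S). \<forall>K\<in>Obj sSet. \<forall>L\<in>Obj sSet.
              \<forall>u\<in>Hom sSet K L. \<forall>f\<in>Hom (und S) Y X.
              scmp K (pre S (P X L) (P X K) X (fmor F (X, L) (X, K) (Ident (und S) X, u))) (\<beta> K X)
                = scmp K (\<beta> L X) u \<and>
              scmp K (pre S (P Y K) (P X K) X (fmor F (Y, K) (X, K) (f, Ident sSet K))) (\<beta> K X)
                = scmp K (post S (P Y K) Y X f) (\<beta> K Y))))"
proof (intro conjI allI impI)
  let ?C = "und S" and ?D = "sSet :: ('k sset, nat \<Rightarrow> 'k \<Rightarrow> 'k) category"
  note S = assms(1)
  note C = is_category_und[OF S]
  note [simp] = is_categoryD(1)[OF C] shom_Ident[OF S] shom_sset[OF S] sid_smap scmp_sid scmp_smap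
  fix T \<alpha> \<phi>
  assume cyl: "\<forall>X\<in>Obj ?C. \<forall>K\<in>Obj ?D. is_cylinder S K X (T X K, \<alpha> K X, \<phi> K X)"
  let ?T = "\<lambda>(X, K). T X K" and ?\<alpha> = "\<lambda>(X, K). \<alpha> K X" and ?H = "cylinder_functor S"
  have T [simp]: "T X K \<in> Obj ?C" and \<alpha> [simp]: "\<alpha> K X \<in> smap K (SH S X (T X K))"
    if "X \<in> Obj ?C" "K \<in> Obj ?D" for X K
    using cyl that unfolding is_cylinder_def by auto
  note H = cylinder_functor_simps[OF S]
  have ex1: "\<exists>!F. is_functor (prod_cat ?C ?D) ?C F \<and>
    (\<forall>X\<in>Obj ?C. \<forall>K\<in>Obj ?D. fobj F (X, K) = ?T (X, K)) \<and>
    (\<forall>X\<in>Obj ?C. \<forall>Y\<in>Obj ?C. \<forall>K\<in>Obj ?D. \<forall>L\<in>Obj ?D. \<forall>u\<in>Hom ?D K L. \<forall>f\<in>Hom ?C X Y.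
       natural_at (prod_cat ?C ?D) ?C ?H ?T ?\<alpha> (X, K) (X, L) (Ident ?C X, u)
         (fmor F (X, K) (X, L) (Ident ?C X, u)) \<and>
       natural_at (prod_cat ?C ?D) ?C ?H ?T ?\<alpha> (X, K) (Y, K) (f, Ident ?D K)
         (fmor F (X, K) (Y, K) (f, Ident ?D K)))"
  proof (rule representing_functor_prod[OF C is_category_sSet C is_functor_cylinder_functor[OF S]])
    fix b :: "'o \<times> 'k sset" and y m
    assume b: "b \<in> Obj (prod_cat ?C ?D)"
    then obtain X K where XK: "b = (X, K)" "X \<in> Obj ?C" "K \<in> Obj ?D" by auto
    then show "?T b \<in> Obj ?C" "?\<alpha> b \<in> fobj ?H (b, ?T b)" by (simp_all add: H)
    assume y: "y \<in> Obj ?C" and m: "m \<in> fobj ?H (b, y)"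
    \<comment> \<open>The parameter \<open>(X, K)\<close> is held at its identity, so only the
      action of \<open>g\<close> on \<open>\<alpha> K X\<close> remains and the universality
      hypothesis becomes \<open>cylinder_universal\<close>.\<close>
    have "fmor ?H ((X, K), T X K) ((X, K), y) ((Ident ?C X, sid K), g) (\<alpha> K X)
        = scmp K (post S X (T X K) y g) (\<alpha> K X)" if "g \<in> Hom ?C (T X K) y" for g
      using that XK y by (simp add: H post_def scmp_sid[OF \<alpha>])
    then show "\<exists>!g. g \<in> Hom ?C (?T b) y \<and>
        fmor ?H (b, ?T b) (b, y) (Ident (prod_cat ?C ?D) b, g) (?\<alpha> b) = m"
      using cylinder_universal[OF S bspec[OF bspec[OF cyl XK(2)] XK(3)] XK(3,2) y, of m] m XK y
      by (simp add: H cong: conj_cong)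
  qed
  show "\<exists>!F. is_functor (prod_cat ?C ?D) ?C F \<and>
      (\<forall>X\<in>Obj ?C. \<forall>K\<in>Obj sSet. fobj F (X, K) = T X K) \<and>
      (\<forall>X\<in>Obj ?C. \<forall>Y\<in>Obj ?C. \<forall>K\<in>Obj sSet. \<forall>L\<in>Obj sSet.
         \<forall>u\<in>Hom sSet K L. \<forall>f\<in>Hom ?C X Y.
         scmp K (post S X (T X K) (T X L) (fmor F (X, K) (X, L) (Ident ?C X, u))) (\<alpha> K X)
           = scmp K (\<alpha> L X) u \<and>
         scmp K (post S X (T X K) (T Y K) (fmor F (X, K) (Y, K) (f, Ident sSet K))) (\<alpha> K X)
           = scmp K (pre S X Y (T Y K) f) (\<alpha> K Y))"
    (is "\<exists>!F. ?P F")
  proof -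
    \<comment> \<open>On the right side of naturality at \<open>(id, u)\<close> the action on the
      simplicial hom is an identity, which leaves \<open>\<alpha> L X\<close> precomposed with
      \<open>u\<close>.\<close>
    have 1: "natural_at (prod_cat ?C ?D) ?C ?H ?T ?\<alpha> (X, K) (X, L) (Ident ?C X, u) g
        \<longleftrightarrow> scmp K (post S X (T X K) (T X L) g) (\<alpha> K X) = scmp K (\<alpha> L X) u"
      if "X \<in> Obj ?C" "K \<in> Obj ?D" "L \<in> Obj ?D" "u \<in> smap K L" "g \<in> Hom ?C (T X K) (T X L)"
      for X K L u g
      using that scmp_sid(2)[OF scmp_smap[OF that(2,4) \<alpha>]]
      by (simp add: natural_at_def H post_def scmp_sid[OF \<alpha>])
    have 2: "natural_at (prod_cat ?C ?D) ?C ?H ?T ?\<alpha> (X, K) (Y, K) (f, sid K) g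
        \<longleftrightarrow> scmp K (post S X (T X K) (T Y K) g) (\<alpha> K X) = scmp K (pre S X Y (T Y K) f) (\<alpha> K Y)"
      if "X \<in> Obj ?C" "Y \<in> Obj ?C" "K \<in> Obj ?D" "f \<in> Hom ?C X Y" "g \<in> Hom ?C (T X K) (T Y K)"
      for X Y K f g
      using that by (simp add: natural_at_def H post_def pre_def scmp_sid[OF \<alpha>])
    \<comment> \<open>The equivalences \<open>1\<close> and \<open>2\<close> presuppose that the
      values of \<open>F\<close> lie in the right hom sets. This follows from the first two
      conjuncts, hence the rewriting under \<open>conj_cong\<close>.\<close>
    have mem: "fmor F (X, K) (Y, L) (f, u) \<in> Hom ?C (T X K) (T Y L)"
      if "is_functor (prod_cat ?C ?D) ?C F" "\<forall>X\<in>Obj ?C. \<forall>K\<in>Obj ?D. fobj F (X, K) = T X K"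
        "X \<in> Obj ?C" "Y \<in> Obj ?C" "K \<in> Obj ?D" "L \<in> Obj ?D" "f \<in> Hom ?C X Y" "u \<in> smap K L"
      for F X Y K L f u
      using is_functorD(2)[OF that(1), of "(X, K)" "(Y, L)" "(f, u)"] that(2-8) by simp
    show ?thesis
      using ex1 by (simp add: 1 2 mem cong: conj_cong ball_cong)
  qed
next
  let ?C = "und S" and ?D = "sSet :: ('k sset, nat \<Rightarrow> 'k \<Rightarrow> 'k) category"
  let ?E = "opposite ?D"
  note S = assms(1)
  note C = is_category_und[OF S]
  note [simp] = is_categoryD(1)[OF C] shom_Ident[OF S] shom_sset[OF S] sid_smap scmp_sid scmp_smap
  fix P \<beta> \<psi>
  assume path: "\<forall>X\<in>Obj ?C. \<forall>K\<in>Obj ?D. is_path S K X (P X K, \<beta> K X, \<lambda>Y. \<psi> K Y X)"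
  let ?T = "\<lambda>(X, K). P X K" and ?\<beta> = "\<lambda>(X, K). \<beta> K X" and ?H = "path_functor S"
  have P [simp]: "P X K \<in> Obj ?C" and \<beta> [simp]: "\<beta> K X \<in> smap K (SH S (P X K) X)"
    if "X \<in> Obj ?C" "K \<in> Obj ?D" for X K
    using path that unfolding is_path_def by auto
  note H = path_functor_simps[OF S]
  let ?N = "natural_at (prod_cat ?C ?E) (opposite ?C) ?H ?T ?\<beta>"
  \<comment> \<open>\<open>Hom ?E L K\<close> unfolds to \<open>Hom ?D K L\<close>, so
    \<open>u\<close> runs over maps from \<open>K\<close> to \<open>L\<close> although its image
    goes from \<open>P X L\<close> to \<open>P X K\<close>.\<close>
  have ex1: "\<exists>!F. is_functor (prod_cat ?C ?E) ?C F \<and>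
    (\<forall>X\<in>Obj ?C. \<forall>K\<in>Obj ?E. fobj F (X, K) = ?T (X, K)) \<and>
    (\<forall>X\<in>Obj ?C. \<forall>Y\<in>Obj ?C. \<forall>K\<in>Obj ?E. \<forall>L\<in>Obj ?E. \<forall>u\<in>Hom ?E L K. \<forall>f\<in>Hom ?C Y X.
       ?N (X, K) (X, L) (Ident ?C X, u) (fmor F (X, L) (X, K) (Ident ?C X, u)) \<and>
       ?N (X, K) (Y, K) (f, Ident ?E K) (fmor F (Y, K) (X, K) (f, Ident ?E K)))"
  proof (rule corepresenting_functor_prod[OF C is_category_opposite[OF is_category_sSet] C
        is_functor_path_functor[OF S]])
    fix b :: "'o \<times> 'k sset" and y m
    assume b: "b \<in> Obj (prod_cat ?C ?E)"
    then obtain X K where XK: "b = (X, K)" "X \<in> Obj ?C" "K \<in> Obj ?D" by auto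
    then show "?T b \<in> Obj ?C" "?\<beta> b \<in> fobj ?H (b, ?T b)" by (simp_all add: H)
    assume y: "y \<in> Obj ?C" and m: "m \<in> fobj ?H (b, y)"
    have "fmor ?H ((X, K), P X K) ((X, K), y) ((Ident ?C X, sid K), g) (\<beta> K X)
        = scmp K (pre S y (P X K) X g) (\<beta> K X)" if "g \<in> Hom ?C y (P X K)" for g
      using that XK y by (simp add: H pre_def scmp_sid[OF \<beta>])
    then show "\<exists>!g. g \<in> Hom ?C y (?T b) \<and>
        fmor ?H (b, ?T b) (b, y) (Ident (prod_cat ?C ?E) b, g) (?\<beta> b) = m"
      using path_universal[OF S bspec[OF bspec[OF path XK(2)] XK(3)] XK(3,2) y, of m] m XK y
      by (simp add: H cong: conj_cong)
  qed
  show "\<exists>!F. is_functor (prod_cat ?C ?E) ?C F \<and>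
      (\<forall>X\<in>Obj ?C. \<forall>K\<in>Obj sSet. fobj F (X, K) = P X K) \<and>
      (\<forall>X\<in>Obj ?C. \<forall>Y\<in>Obj ?C. \<forall>K\<in>Obj sSet. \<forall>L\<in>Obj sSet.
         \<forall>u\<in>Hom sSet K L. \<forall>f\<in>Hom ?C Y X.
         scmp K (pre S (P X L) (P X K) X (fmor F (X, L) (X, K) (Ident ?C X, u))) (\<beta> K X)
           = scmp K (\<beta> L X) u \<and>
         scmp K (pre S (P Y K) (P X K) X (fmor F (Y, K) (X, K) (f, Ident sSet K))) (\<beta> K X)
           = scmp K (post S (P Y K) Y X f) (\<beta> K Y))"
  proof -
    have 1: "?N (X, K) (X, L) (Ident ?C X, u) g
        \<longleftrightarrow> scmp K (pre S (P X L) (P X K) X g) (\<beta> K X) = scmp K (\<beta> L X) u"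
      if "X \<in> Obj ?C" "K \<in> Obj ?D" "L \<in> Obj ?D" "u \<in> smap K L" "g \<in> Hom ?C (P X L) (P X K)"
      for X K L u g
      using that scmp_sid(2)[OF scmp_smap[OF that(2,4) \<beta>]]
      by (simp add: natural_at_def H pre_def scmp_sid[OF \<beta>])
    \<comment> \<open>Compared with cylinders, \<open>f\<close> acts covariantly on the simplicial
      hom and \<open>g\<close> contravariantly, so \<open>pre\<close> and \<open>post\<close> change
      sides.\<close>
    have 2: "?N (X, K) (Y, K) (f, sid K) g
        \<longleftrightarrow> scmp K (pre S (P Y K) (P X K) X g) (\<beta> K X) = scmp K (post S (P Y K) Y X f) (\<beta> K Y)"
      if "X \<in> Obj ?C" "Y \<in> Obj ?C" "K \<in> Obj ?D" "f \<in> Hom ?C Y X" "g \<in> Hom ?C (P Y K) (P X K)"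
      for X Y K f g
      using that by (simp add: natural_at_def H post_def pre_def scmp_sid[OF \<beta>])
    have mem: "fmor F (X, K) (Y, L) (f, u) \<in> Hom ?C (P X K) (P Y L)"
      if "is_functor (prod_cat ?C ?E) ?C F" "\<forall>X\<in>Obj ?C. \<forall>K\<in>Obj ?D. fobj F (X, K) = P X K"
        "X \<in> Obj ?C" "Y \<in> Obj ?C" "K \<in> Obj ?D" "L \<in> Obj ?D" "f \<in> Hom ?C X Y" "u \<in> smap L K"
      for F X Y K L f u
      using is_functorD(2)[OF that(1), of "(X, K)" "(Y, L)" "(f, u)"] that(2-8) by simp
    show ?thesis
      using ex1 by (simp add: 1 2 mem cong: conj_cong ball_cong)
  qed
qed

end
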